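(* For every integer $n\ge 0$, the terms of $\mathrm{Cat}_n(q,t)$ of total degree at least $\binom n2-11$ are symmetric in $q$ and $t$; that is, for all integers $i,j\ge 0$ with $i+j\ge\binom n2-11$, the coefficient of $q^it^j$ in $\mathrm{Cat}_n(q,t)$ equals the coefficient of $q^jt^i$ in $\mathrm{Cat}_n(q,t)$.
   Context: An integer partition $\gamma=(\gamma_1\ge\cdots\ge\gamma_s>0)$ (possibly empty) has length $\ell(\gamma)=s$ and size $|\gamma|=\sum\gamma_i$. Its diagram is the set of cells $(i,j)$ with $1\le i\le \ell(\gamma)$, $1\le j\le\gamma_i$; $\gamma'$ is the conjugate partition. For a cell $c=(i,j)$, $\mathrm{arm}(c)=\gamma_i-j$ and $\mathrm{leg}(c)=\gamma'_j-i$. $\mathrm{dinv}(\gamma)$ is the number of cells $c$ of the diagram with $\mathrm{arm}(c)-\mathrm{leg}(c)\in\{0,1\}$. $\min_\Delta(\gamma)$ is the least positive integer $n$ such that $\gamma_i\le n-i$ for $1\le i\le\ell(\gamma)$ (i.e. the diagram of $\gamma$ fits inside the diagram $\Delta_n$ of $(n-1,n-2,\ldots,1)$), and $\mathrm{DP}(n)=\{\gamma:\min_\Delta(\gamma)\le n\}$ is the set of partitions whose diagram is contained in $\Delta_n$. The $q,t$-Catalan number is $$\mathrm{Cat}_n(q,t)=\sum_{\gamma\in\mathrm{DP}(n)}q^{\binom n2-|\gamma|}\,t^{\mathrm{dinv}(\gamma)}.$$ *)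

theory Defs
  imports "HOL-Computational_Algebra.Polynomial"
begin

text \<open>Integer partitions are weakly decreasing lists of positive naturals; indices of parts
  start at 1, and parts beyond the length are 0.\<close>

definition is_partition :: "nat list \<Rightarrow> bool" where
  "is_partition \<gamma> \<longleftrightarrow> sorted_wrt (\<ge>) \<gamma> \<and> (\<forall>x\<in>set \<gamma>. 0 < x)"

definition part :: "nat list \<Rightarrow> nat \<Rightarrow> nat" where
  "part \<gamma> i = (if 1 \<le> i \<and> i \<le> length \<gamma> then \<gamma> ! (i - 1) else 0)"

definition diagram :: "nat list \<Rightarrow> (nat \<times> nat) set" where
  "diagram \<gamma> = {(i, j). 1 \<le> i \<and> i \<le> length \<gamma> \<and> 1 \<le> j \<and> j \<le> part \<gamma> i}"

definition conjugate :: "nat list \<Rightarrow> nat list" where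
  "conjugate \<gamma> = map (\<lambda>j. card {i. (i, j) \<in> diagram \<gamma>}) [1..<Suc (part \<gamma> 1)]"

definition arm :: "nat list \<Rightarrow> nat \<times> nat \<Rightarrow> int" where
  "arm \<gamma> c = int (part \<gamma> (fst c)) - int (snd c)"

definition leg :: "nat list \<Rightarrow> nat \<times> nat \<Rightarrow> int" where
  "leg \<gamma> c = int (part (conjugate \<gamma>) (snd c)) - int (fst c)"

definition dinv :: "nat list \<Rightarrow> nat" where
  "dinv \<gamma> = card {c \<in> diagram \<gamma>. arm \<gamma> c - leg \<gamma> c \<in> {0, 1}}"

definition min_Delta :: "nat list \<Rightarrow> nat" where
  "min_Delta \<gamma> = (LEAST n. 0 < n \<and> (\<forall>i\<in>{1..length \<gamma>}. int (part \<gamma> i) \<le> int n - int i))"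

definition DP :: "nat \<Rightarrow> nat list set" where
  "DP n = {\<gamma>. is_partition \<gamma> \<and> min_Delta \<gamma> \<le> n}"

text \<open>Polynomials in \<open>q\<close> and \<open>t\<close> are polynomials in \<open>q\<close> whose coefficients are polynomials in \<open>t\<close>,
  so the coefficient of \<open>q\<^sup>i t\<^sup>j\<close> in \<open>P\<close> is \<open>coeff (coeff P i) j\<close>.\<close>

definition q_var :: "int poly poly" where
  "q_var = [:0, 1:]"

definition t_var :: "int poly poly" where
  "t_var = [:[:0, 1:]:]"

definition coeff_qt :: "int poly poly \<Rightarrow> nat \<Rightarrow> nat \<Rightarrow> int" where
  "coeff_qt P i j = coeff (coeff P i) j"

definition Cat :: "nat \<Rightarrow> int poly poly" where
  "Cat n = (\<Sum>\<gamma>\<in>DP n. q_var ^ ((n choose 2) - sum_list \<gamma>) * t_var ^ dinv \<gamma>)"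

text \<open>The sum is over a finite set, and the exponent of \<open>q\<close> is never truncated.\<close>

lemma DP_part_le:
  assumes "\<gamma> \<in> DP n" "i < length \<gamma>"
  shows "\<gamma> ! i + Suc i \<le> n"
proof -
  let ?P = "\<lambda>n. 0 < n \<and> (\<forall>i\<in>{1..length \<gamma>}. int (part \<gamma> i) \<le> int n - int i)"
  have bnd: "part \<gamma> k \<le> sum_list \<gamma>" for k
    by (auto simp: part_def intro!: member_le_sum_list)
  have "?P (Suc (sum_list \<gamma> + length \<gamma>))"
  proof (intro conjI ballI)
    fix k assume "k \<in> {1..length \<gamma>}"
    then show "int (part \<gamma> k) \<le> int (Suc (sum_list \<gamma> + length \<gamma>)) - int k"
      using bnd[of k] by auto
  qed simp
  then have "?P (min_Delta \<gamma>)"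
    unfolding min_Delta_def by (rule LeastI)
  moreover have "Suc i \<in> {1..length \<gamma>}"
    using assms(2) by auto
  ultimately have "int (part \<gamma> (Suc i)) \<le> int (min_Delta \<gamma>) - int (Suc i)"
    by blast
  moreover have "min_Delta \<gamma> \<le> n"
    using assms(1) by (simp add: DP_def)
  ultimately show ?thesis
    using assms(2) by (simp add: part_def)
qed

lemma DP_length_le:
  assumes "\<gamma> \<in> DP n"
  shows "length \<gamma> \<le> n"
  using DP_part_le[OF assms, of "length \<gamma> - 1"] by (cases \<gamma>) auto

lemma finite_DP: "finite (DP n)"
proof (rule finite_subset)
  show "DP n \<subseteq> {xs. set xs \<subseteq> {..n} \<and> length xs \<le> n}"
    using DP_part_le DP_length_le by (fastforce simp: in_set_conv_nth)
  show "finite {xs. set xs \<subseteq> {..n} \<and> length xs \<le> n}"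
    by (rule finite_lists_length_le) simp
qed

lemma DP_size_le:
  assumes "\<gamma> \<in> DP n"
  shows "sum_list \<gamma> \<le> n choose 2"
proof -
  have "sum_list \<gamma> = (\<Sum>i<length \<gamma>. \<gamma> ! i)"
    by (simp add: sum_list_sum_nth atLeast0LessThan)
  also have "\<dots> \<le> (\<Sum>i<length \<gamma>. n - Suc i)"
  proof (rule sum_mono)
    fix i assume "i \<in> {..<length \<gamma>}"
    then show "\<gamma> ! i \<le> n - Suc i"
      using DP_part_le[OF assms, of i] by simp
  qed
  also have "\<dots> \<le> (\<Sum>i<n. n - Suc i)"
    using DP_length_le[OF assms] by (intro sum_mono2) auto
  also have "\<dots> = \<Sum>{..<n}"
    by (rule sum.nat_diff_reindex)
  also have "\<dots> = n choose 2"
    by (induction n) (auto simp: numeral_2_eq_2)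
  finally show ?thesis .
qed

lemma coeff_qt_Cat:
  "coeff_qt (Cat n) i j
     = int (card {\<gamma> \<in> DP n. (n choose 2) - sum_list \<gamma> = i \<and> dinv \<gamma> = j})"
proof -
  have mono: "q_var ^ a * t_var ^ b = monom (monom 1 b) a" for a b
  proof -
    have "q_var ^ a = monom 1 a"
      unfolding q_var_def by (simp only: monom_altdef smult_1_left)
    moreover have "t_var ^ b = [:monom 1 b:]"
      unfolding t_var_def by (induction b) (simp_all add: monom_Suc flip: one_pCons)
    ultimately show ?thesis
      by (simp add: mult_monom flip: monom_0)
  qed
  have "coeff_qt (Cat n) i j
      = (\<Sum>\<gamma>\<in>DP n. if (n choose 2) - sum_list \<gamma> = i \<and> dinv \<gamma> = j then 1 else 0)"
    by (simp add: coeff_qt_def Cat_def mono coeff_sum cong: sum.cong)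
      (auto intro!: sum.cong)
  then show ?thesis
    by (simp add: finite_DP sum.If_cases Int_def)
qed

end

theory Submission
  imports Defs "HOL-Library.Multiset"
begin

text \<open>A partition in \<open>DP n\<close> is the same thing as a Dyck word of length \<open>n\<close>: the \<open>i\<close>-th letter
from the end counts the cells of row \<open>i\<close> of the staircase that the partition leaves free. The
exponent of \<open>q\<close> becomes the sum of the letters, and a row-by-row crossing argument
(\<open>links_word_of\<close>) turns dinv into the number \<open>winv\<close> of pairs of rows in which the letter of the
lower row exceeds that of the higher row by 0 or 1. The remaining pairs, after a forced number of
them is discounted, form the \<open>defect\<close>, and area, \<open>winv\<close> and \<open>defect\<close> add up to \<open>n choose 2\<close>
(\<open>winv_defect_area\<close>). So the claim is that for each defect \<open>k \<le> 11\<close> the number \<open>p d\<close> of words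
with \<open>winv = d\<close> is invariant under \<open>d \<mapsto> (n choose 2) - k - d\<close>.

Taking the top letter off the initial run \<open>0, 1, 2, \<dots>\<close> of a word and putting it, lowered by one,
at the other end raises \<open>winv\<close> by one and keeps the defect. This partial injection arranges the
words of length \<open>n\<close> and defect \<open>k\<close> into chains. A chain starts at a word satisfying \<open>start\<close>, and
it ends either at a \<open>dead_end\<close> or at a word whose initial run consists of the letter 0 alone. The
point is that starts and dead ends nearly cancel: the starts with \<open>winv = d\<close> are as many as the
dead ends with \<open>winv + 1 = d\<close> together with the words of run 1 and area \<open>d\<close> (\<open>balanced\<close>). Given
this, \<open>p (d + 1) - p d\<close> is the number of run-1 words of area \<open>d + 1\<close> minus the number of those of
area \<open>e\<close>, where \<open>d + e + k = n choose 2\<close>. That difference changes sign under the reflection,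
which forces \<open>p\<close> to be symmetric.

Balance is proved by induction on \<open>n\<close>. Raising all letters by one and adding a new letter 0 at
the beginning of a word embeds length \<open>n\<close> into length \<open>n + 1\<close> and respects starts and dead ends,
so only words with at least two letters 0 are new. A second 0 is expensive: starts and dead ends
with two zeros have defect at least \<open>n - 3\<close>, and a run-1 word that contains a letter above 1, or
that does not have the letter 0 at its far end, has defect at least \<open>n - 2\<close>. Hence for \<open>n \<ge> k +
3\<close> the step from \<open>n\<close> to \<open>n + 1\<close> produces no new starts or dead ends, and the run-1 words merely
acquire a final 0 (\<open>balanced_step_large\<close>). The steps up to length 14 are a finite verification,
carried out by a search through the tree of Dyck words, pruned by a quantity that never decreases
along a branch (\<open>search_value\<close>).\<close>

section \<open>Dyck words and their statistics\<close>

text \<open>Words are stored backwards: the head of the list is the last letter of the word and the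
letter 0 at the bottom of the list is its first one. Then the head belongs to the longest row of
the partition, and a word is extended by consing.\<close>

fun dyck :: "nat list \<Rightarrow> bool" where
  "dyck [] = True"
| "dyck [a] = (a = 0)"
| "dyck (a # b # u) = (a \<le> Suc b \<and> dyck (b # u))"

primrec links :: "nat \<Rightarrow> nat list \<Rightarrow> nat" where
  "links a [] = 0"
| "links a (x # u) = (if x = a \<or> x = Suc a then Suc (links a u) else links a u)"

primrec winv :: "nat list \<Rightarrow> nat" where
  "winv [] = 0"
| "winv (a # u) = winv u + links a u"

text \<open>When \<open>a\<close> is put in front of \<open>u\<close>, each of the levels \<open>0, \<dots>, a - 1\<close> already occurs in \<open>u\<close>.
These \<open>a\<close> forced pairs make up the area contributed by \<open>a\<close>, and the cost counts the unlinked
pairs beyond them; in a Dyck word neither subtraction is truncated.\<close>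

definition cost :: "nat \<Rightarrow> nat list \<Rightarrow> nat" where
  "cost a u = length u - a - links a u"

primrec defect :: "nat list \<Rightarrow> nat" where
  "defect [] = 0"
| "defect (a # u) = defect u + cost a u"

primrec stair :: "nat \<Rightarrow> nat list" where
  "stair 0 = []"
| "stair (Suc k) = k # stair k"

text \<open>The number of letters in the initial segment \<open>0, 1, 2, \<dots>\<close> of the word, that is, the length
of the longest staircase at the bottom of the list.\<close>

primrec run :: "nat list \<Rightarrow> nat" where
  "run [] = 0"
| "run (a # u) = (if run u = length u \<and> a = length u then Suc (length u) else run u)"

lemma dyck_ConsD: "dyck (a # u) \<Longrightarrow> dyck u"
  by (cases u) auto

lemma dyck_appendD: "dyck (x @ u) \<Longrightarrow> dyck u"
  by (induction x) (auto dest: dyck_ConsD)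

lemma dyck_Cons_iff: "u \<noteq> [] \<Longrightarrow> dyck (a # u) \<longleftrightarrow> a \<le> Suc (hd u) \<and> dyck u"
  by (cases u) auto

lemma dyck_level_mem:
  assumes "dyck u" "u \<noteq> []" "b \<le> hd u"
  shows "b \<in> set u"
  using assms by (induction u rule: dyck.induct) (auto simp: le_Suc_eq)

lemma dyck_set_less: "dyck u \<Longrightarrow> \<forall>x\<in>set u. x < length u"
  by (induction u rule: dyck.induct) auto

lemma length_stair [simp]: "length (stair k) = k"
  by (induction k) auto

lemma dyck_stair [simp]: "dyck (stair k)"
proof (induction k)
  case (Suc k)
  then show ?case by (cases k) auto
qed simp

lemma set_stair [simp]: "set (stair k) = {..<k}"
  by (induction k) (simp_all add: lessThan_Suc)

lemma length_eq_levels: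
  "length u = (\<Sum>b<a. count_list u b) + links a u + length (filter (\<lambda>x. a + 2 \<le> x) u)"
proof (induction u)
  case (Cons x u)
  have "(\<Sum>b<a. count_list (x # u) b) = (\<Sum>b<a. count_list u b) + (\<Sum>b<a. if b = x then 1 else 0)"
    by (subst sum.distrib [symmetric]) (auto intro: sum.cong)
  also have "(\<Sum>b<a. if b = x then 1 else 0) = (if x < a then 1 else 0 :: nat)"
    by simp
  finally show ?case using Cons by auto
qed simp

text \<open>No step of a Dyck word rises by more than one, so every level below \<open>a\<close> occurs in \<open>u\<close>; one
occurrence of each is split off from its count.\<close>

lemma length_eq_cost:
  assumes "dyck (a # u)"
  shows "length u = a + links a u + (\<Sum>b<a. count_list u b - 1) + length (filter (\<lambda>x. a + 2 \<le> x) u)"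
proof -
  have "count_list u b = 1 + (count_list u b - 1)" if "b < a" for b
  proof -
    have "b \<in> set u"
      using assms that dyck_level_mem[of u b] by (cases u) auto
    then show ?thesis
      using count_list_0_iff[of u b] by linarith
  qed
  then have "(\<Sum>b<a. count_list u b) = (\<Sum>b<a. 1 + (count_list u b - 1))"
    by (intro sum.cong) auto
  also have "\<dots> = a + (\<Sum>b<a. count_list u b - 1)"
    by (subst sum.distrib) simp
  finally show ?thesis
    using length_eq_levels[of u a] by linarith
qed

lemma cost_eq:
  assumes "dyck (a # u)"
  shows "cost a u = (\<Sum>b<a. count_list u b - 1) + length (filter (\<lambda>x. a + 2 \<le> x) u)"
  using length_eq_cost[OF assms] by (simp add: cost_def)

lemma winv_defect_area:
  assumes "dyck u"
  shows "winv u + defect u + sum_list u = length u choose 2"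
  using assms
proof (induction u)
  case (Cons a u)
  then have "a + links a u + cost a u = length u"
    using length_eq_cost[of a u] by (simp add: cost_def)
  with Cons show ?case
    using dyck_ConsD[of a u] by (simp add: numeral_2_eq_2)
qed simp

lemma finite_dyck: "finite {u. dyck u \<and> length u = n \<and> P u}"
proof (rule finite_subset)
  show "{u. dyck u \<and> length u = n \<and> P u} \<subseteq> {u. set u \<subseteq> {..<n} \<and> length u = n}"
    using dyck_set_less by auto
  show "finite {u. set u \<subseteq> {..<n} \<and> length u = n}"
    by (rule finite_lists_length_eq) simp
qed

section \<open>The chain step\<close>

lemma run_le: "run u \<le> length u"
  by (induction u) auto

lemma run_stair [simp]: "run (stair k) = k"
  by (induction k) auto

lemma run_append_stair:
  "x = [] \<or> last x < k \<Longrightarrow> run (x @ stair k) = k"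
  by (induction x) (auto split: if_splits)

lemma run_decomp:
  "dyck u \<Longrightarrow> \<exists>x. u = x @ stair (run u) \<and> (x = [] \<or> last x < run u)"
proof (induction u)
  case (Cons a u)
  then obtain x where x: "u = x @ stair (run u)" "x = [] \<or> last x < run u"
    using dyck_ConsD by blast
  then have len: "length u = length x + run u"
    by (metis length_append length_stair)
  show ?case
  proof (cases "run u = length u \<and> a = length u")
    case True
    with len x have "u = stair (run u)" by simp
    with True have "a # u = [] @ stair (run (a # u))"
      by simp
    then show ?thesis by blast
  next
    case False
    have "a < run u" if "x = []"
    proof (cases "run u")
      case 0
      with that x len False Cons.prems show ?thesis by auto
    next
      case (Suc r)
      with that x have "u = r # stair r" by simp
      with Cons.prems have "a \<le> Suc r" by simp
      with False that len Suc show ?thesis by simp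
    qed
    then have "last (a # x) < run (a # u)"
      using False x(2) by auto
    moreover have "a # u = (a # x) @ stair (run (a # u))"
      using False x(1) by auto
    ultimately show ?thesis by blast
  qed
qed simp

lemma dyck_swap_base:
  assumes "dyck y" "dyck z" "y \<noteq> []" "z \<noteq> []"
    and "x \<noteq> [] \<Longrightarrow> last x \<le> Suc (hd y) \<and> last x \<le> Suc (hd z)"
  shows "dyck (x @ y) \<longleftrightarrow> dyck (x @ z)"
  using assms(5)
proof (induction x)
  case (Cons a x)
  show ?case
  proof (cases x)
    case Nil
    with Cons assms show ?thesis by (auto simp: dyck_Cons_iff)
  next
    case Cons': (Cons b x')
    with Cons show ?thesis by (auto simp: dyck_Cons_iff)
  qed
qed (use assms in auto)

lemma links_append [simp]: "links a (x @ y) = links a x + links a y"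
  by (induction x) auto

lemma links_eq_0: "(\<And>x. x \<in> set u \<Longrightarrow> x < a) \<Longrightarrow> links a u = 0"
  by (induction u) force+

lemma winv_stair [simp]: "winv (stair k) = 0"
  by (induction k) (auto intro!: links_eq_0)

lemma winv_append_stair_Suc:
  "winv (x @ stair (Suc k)) = winv (x @ stair k) + length (filter (\<lambda>a. k = a \<or> k = Suc a) x)"
  by (induction x) (auto intro!: links_eq_0)

lemma links_eq_length_filter: "links c x = length (filter (\<lambda>a. Suc c = a \<or> Suc c = Suc a) x)"
  by (induction x) auto

text \<open>The chain step replaces \<open>x @ stair (c + 2)\<close> by \<open>c # x @ stair (c + 1)\<close>: the top letter \<open>c +
1\<close> of the initial run leaves and the letter \<open>c\<close> arrives at the other end.\<close>

lemma chain_step_dyck: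
  assumes "x \<noteq> [] \<longrightarrow> last x \<le> Suc c"
  shows "dyck (c # x @ stair (Suc c)) \<longleftrightarrow>
    dyck (x @ stair (Suc (Suc c))) \<and> c \<le> Suc (hd (x @ stair (Suc (Suc c))))"
proof -
  have "dyck (x @ stair (Suc c)) \<longleftrightarrow> dyck (x @ stair (Suc (Suc c)))"
    using assms dyck_stair[of "Suc c"] dyck_stair[of "Suc (Suc c)"]
    by (intro dyck_swap_base) auto
  then show ?thesis
    by (cases x) (auto simp: dyck_Cons_iff)
qed

text \<open>The letters of \<open>x\<close> that are linked to the departing \<open>c + 1\<close> below them are the letters \<open>c\<close>
and \<open>c + 1\<close>. These are also the letters to which the new head \<open>c\<close> is linked, so nothing changes
there; but the head has one more link, to the letter \<open>c\<close> of the staircase.\<close>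

lemma chain_step_winv:
  "winv (c # x @ stair (Suc c)) = Suc (winv (x @ stair (Suc (Suc c))))"
proof -
  have "links c (stair c) = 0" by (rule links_eq_0) simp
  then show ?thesis
    by (simp only: winv_append_stair_Suc[of x "Suc c"])
      (simp add: links_eq_length_filter[of c x])
qed

lemma chain_step_area:
  "Suc (sum_list (c # x @ stair (Suc c))) = sum_list (x @ stair (Suc (Suc c)))"
  by simp

lemma chain_step_defect:
  assumes "dyck (c # x @ stair (Suc c))" "dyck (x @ stair (Suc (Suc c)))"
  shows "defect (c # x @ stair (Suc c)) = defect (x @ stair (Suc (Suc c)))"
  using winv_defect_area[OF assms(1)] winv_defect_area[OF assms(2)]
    chain_step_area[of c x] chain_step_winv[of c x] by simp

text \<open>The pairs \<open>(x, c)\<close> at which the chain step is possible. Both its sources and its targets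
are images of this set under injections, which avoids handling the step and its inverse as
partial functions.\<close>

definition steps :: "(nat list \<times> nat) set" where
  "steps = {(x, c). (x \<noteq> [] \<longrightarrow> last x \<le> Suc c) \<and> dyck (c # x @ stair (Suc c))}"

lemma run_step_source:
  "(x, c) \<in> steps \<Longrightarrow> run (x @ stair (Suc (Suc c))) = Suc (Suc c)"
  by (rule run_append_stair) (auto simp: steps_def)

lemma inj_on_step_source: "inj_on (\<lambda>(x, c). x @ stair (Suc (Suc c))) steps"
proof (rule inj_onI, clarify)
  fix x c y d
  assume eq: "x @ stair (Suc (Suc c)) = y @ stair (Suc (Suc d))"
    and "(x, c) \<in> steps" "(y, d) \<in> steps"
  then have r: "run (x @ stair (Suc (Suc c))) = Suc (Suc c)" "run (y @ stair (Suc (Suc d))) = Suc (Suc d)"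
    using run_step_source by blast+
  have "c = d" using r(1)[unfolded eq] r(2) by (simp del: stair.simps)
  with eq show "x = y \<and> c = d" by simp
qed

lemma inj_on_step_target: "inj_on (\<lambda>(x, c). c # x @ stair (Suc c)) steps"
  by (rule inj_onI) auto

lemma step_source_image:
  "(\<lambda>(x, c). x @ stair (Suc (Suc c))) ` steps = {u. dyck u \<and> 2 \<le> run u \<and> run u \<le> hd u + 3}"
  (is "?f ` _ = ?A")
proof (intro equalityI subsetI)
  fix u assume "u \<in> ?f ` steps"
  then obtain x c where u: "u = x @ stair (Suc (Suc c))" and xc: "(x, c) \<in> steps" by auto
  then have "run u = Suc (Suc c)"
    using run_step_source by blast
  moreover have "dyck u" "c \<le> Suc (hd u)"
    using xc chain_step_dyck[of x c] by (auto simp only: steps_def u split: prod.splits)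
  ultimately show "u \<in> ?A" by auto
next
  fix u assume u: "u \<in> ?A"
  then obtain x where x: "u = x @ stair (run u)" "x = [] \<or> last x < run u"
    using run_decomp by blast
  obtain c where c: "run u = Suc (Suc c)"
    using u le_Suc_ex[of 2 "run u"] by auto
  have "(x, c) \<in> steps"
    using chain_step_dyck[of x c] x u c by (auto simp: steps_def simp del: stair.simps)
  then show "u \<in> ?f ` steps"
    using x c by (metis (mono_tags, lifting) case_prod_conv image_eqI)
qed

lemma stair_split: "c \<le> k \<Longrightarrow> \<exists>y. stair k = y @ stair c"
  by (induction k) (auto simp: le_Suc_eq intro: exI[of _ "[]"] exI[of _ "_ # _"])

lemma step_target_image:
  "(\<lambda>(x, c). c # x @ stair (Suc c)) ` steps = {u. dyck u \<and> run u < length u \<and> hd u < run u}"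
  (is "?g ` _ = ?B")
proof (intro equalityI subsetI)
  fix u assume "u \<in> ?g ` steps"
  then obtain x c where u: "u = c # x @ stair (Suc c)" and xc: "(x, c) \<in> steps" by auto
  have ge: "Suc c \<le> run (x @ stair (Suc c))" for x
  proof (induction x)
    case Nil then show ?case using run_stair[of "Suc c"] by simp
  next
    case (Cons a x) then show ?case using run_le[of "x @ stair (Suc c)"] by auto
  qed
  have r: "run u = run (x @ stair (Suc c))" using u by simp
  show "u \<in> ?B"
    using xc ge[of x] r run_le[of "x @ stair (Suc c)"] u by (auto simp: steps_def simp del: stair.simps)
next
  fix u assume u: "u \<in> ?B"
  then obtain c w where w: "u = c # w" by (cases u) auto
  then have r: "run u = run w" "c < run w" using u by (auto split: if_splits)
  obtain x where x: "w = x @ stair (run w)"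
    using run_decomp u w dyck_ConsD by blast
  obtain y where "stair (run w) = y @ stair (Suc c)"
    using stair_split r by (metis Suc_leI)
  then have w': "w = (x @ y) @ stair (Suc c)" using x by simp
  have "last z \<le> Suc c" if "z \<noteq> []" "dyck (z @ stair (Suc c))" for z
    using that
  proof (induction z)
    case (Cons a z)
    then show ?case using dyck_ConsD[of a "z @ stair (Suc c)"] by (cases z) auto
  qed simp
  then have "(x @ y, c) \<in> steps"
    using u w w' dyck_ConsD unfolding steps_def by blast
  then show "u \<in> ?g ` steps"
    using w w' by (metis (mono_tags, lifting) case_prod_conv image_eqI)
qed

definition words :: "nat \<Rightarrow> nat \<Rightarrow> nat list set" where
  "words n k = {u. dyck u \<and> length u = n \<and> defect u = k}"

lemma finite_words [simp]: "finite {u \<in> words n k. P u}" "finite (words n k)"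
  using finite_dyck[of n "\<lambda>u. defect u = k \<and> P u"] finite_dyck[of n "\<lambda>u. defect u = k"]
  by (simp_all add: words_def conj_assoc)

lemma card_sources_eq_card_targets:
  "card {u \<in> words n k. (2 \<le> run u \<and> run u \<le> hd u + 3) \<and> winv u = d} =
   card {u \<in> words n k. (run u < length u \<and> hd u < run u) \<and> winv u = Suc d}"
  (is "card ?A = card ?B")
proof -
  let ?f = "\<lambda>(x, c). x @ stair (Suc (Suc c))" and ?g = "\<lambda>(x, c). c # x @ stair (Suc c)"
  let ?T = "{p \<in> steps. ?f p \<in> words n k \<and> winv (?f p) = d}"
  have iff: "?f p \<in> words n k \<and> winv (?f p) = d \<longleftrightarrow> ?g p \<in> words n k \<and> winv (?g p) = Suc d"
    if "p \<in> steps" for p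
  proof (cases p)
    case (Pair x c)
    have "dyck (?g p)" using that Pair by (simp add: steps_def)
    moreover have "dyck (?f p)"
      using that Pair chain_step_dyck[of x c] by (auto simp: steps_def simp del: stair.simps)
    ultimately show ?thesis
      using chain_step_winv[of c x] chain_step_defect[of c x] Pair
      by (auto simp: words_def simp del: winv.simps defect.simps stair.simps)
  qed
  have "?A = ?f ` ?T"
  proof -
    have "?A = {u \<in> ?f ` steps. u \<in> words n k \<and> winv u = d}"
      unfolding step_source_image by (auto simp: words_def)
    then show ?thesis by (simp only: Compr_image_eq)
  qed
  moreover have "?B = ?g ` ?T"
  proof -
    have "?T = {p \<in> steps. ?g p \<in> words n k \<and> winv (?g p) = Suc d}"
      using iff by blast
    moreover have "?B = {u \<in> ?g ` steps. u \<in> words n k \<and> winv u = Suc d}"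
      unfolding step_target_image by (auto simp: words_def)
    ultimately show ?thesis by (simp only: Compr_image_eq)
  qed
  moreover have "card (?f ` ?T) = card ?T"
    by (rule card_image, rule inj_on_subset[OF inj_on_step_source], rule Collect_restrict)
  moreover have "card (?g ` ?T) = card ?T"
    by (rule card_image, rule inj_on_subset[OF inj_on_step_target], rule Collect_restrict)
  ultimately show ?thesis by (simp only:)
qed

section \<open>Lower bounds for the defect\<close>

definition two_zeros :: "nat list \<Rightarrow> bool" where
  "two_zeros u \<longleftrightarrow> 0 \<in> set (butlast u)"

abbreviation high :: "nat list \<Rightarrow> nat" where
  "high u \<equiv> length (filter (\<lambda>x. 2 \<le> x) u)"

lemma dyck_last: "dyck u \<Longrightarrow> u \<noteq> [] \<Longrightarrow> last u = 0"
  by (induction u rule: dyck.induct) auto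

lemma two_zeros_Cons [simp]: "u \<noteq> [] \<Longrightarrow> two_zeros (a # u) \<longleftrightarrow> a = 0 \<or> two_zeros u"
  by (auto simp: two_zeros_def)

lemma not_two_zeros_short [simp]: "\<not> two_zeros []" "\<not> two_zeros [a]"
  by (auto simp: two_zeros_def)

lemma two_zeros_count:
  assumes "dyck u" "two_zeros u"
  shows "2 \<le> count_list u 0"
proof -
  have "u \<noteq> []" using assms by auto
  then obtain v where u: "u = v @ [0]"
    using dyck_last[of u] assms by (metis append_butlast_last_id)
  then have "count_list v 0 \<noteq> 0"
    using assms by (simp add: two_zeros_def count_list_0_iff)
  then show ?thesis using u by simp
qed

lemma length_eq_low_high: "length u = count_list u 0 + count_list u 1 + high u"
  by (induction u) auto

lemma cost_0: "dyck (0 # u) \<Longrightarrow> cost 0 u = high u"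
  by (simp add: cost_eq numeral_2_eq_2)

lemma cost_ge_zeros:
  assumes "dyck (a # u)" "1 \<le> a"
  shows "count_list u 0 - 1 \<le> cost a u"
proof -
  have "(\<Sum>b\<in>{0}. count_list u b - 1) \<le> (\<Sum>b<a. count_list u b - 1)"
    using assms(2) by (intro sum_mono2) auto
  then show ?thesis using cost_eq[OF assms(1)] by simp
qed

lemma cost_ge_low:
  assumes "dyck (a # u)" "2 \<le> a"
  shows "(count_list u 0 - 1) + (count_list u 1 - 1) \<le> cost a u"
proof -
  have "(\<Sum>b\<in>{0, 1}. count_list u b - 1) \<le> (\<Sum>b<a. count_list u b - 1)"
    using assms(2) by (intro sum_mono2) auto
  then show ?thesis using cost_eq[OF assms(1)] by simp
qed

lemma cost_pos_two_zeros:
  assumes "dyck (a # u)" "two_zeros u" "1 \<le> a"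
  shows "1 \<le> cost a u"
  using cost_ge_zeros[OF assms(1,3)] two_zeros_count[OF dyck_ConsD[OF assms(1)] assms(2)] by simp

lemma cost_pos_high:
  assumes "dyck (a # u)" "x \<in> set u" "a + 2 \<le> x"
  shows "1 \<le> cost a u"
proof -
  have "filter (\<lambda>x. a + 2 \<le> x) u \<noteq> []"
    using assms(2,3) by (auto simp: filter_empty_conv)
  then have "1 \<le> length (filter (\<lambda>x. a + 2 \<le> x) u)"
    by (cases "filter (\<lambda>x. a + 2 \<le> x) u") auto
  then show ?thesis using cost_eq[OF assms(1)] by simp
qed

text \<open>Once a word has two zeros and a letter above 1, every further letter costs something: a
positive letter sees a surplus 0, and the letter 0 sees the letter above 1.\<close>

lemma defect_ge_late:
  assumes "dyck (y @ u)" "two_zeros u" "x \<in> set u" "2 \<le> x"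
  shows "length y + defect u \<le> defect (y @ u)"
  using assms(1)
proof (induction y)
  case (Cons a y)
  have "u \<noteq> []" using assms(3) by auto
  then have "two_zeros (y @ u)"
    using assms(2) by (simp add: two_zeros_def butlast_append)
  then have "1 \<le> cost a (y @ u)"
    using Cons.prems cost_pos_two_zeros[of a "y @ u"] cost_pos_high[of a "y @ u" x] assms(3,4)
    by (cases "a = 0") auto
  then show ?case using Cons dyck_ConsD by fastforce
qed simp

lemma run_1_decomp:
  assumes "dyck u" "run u = 1" "u \<noteq> [0]"
  obtains w where "u = w @ [0, 0]"
proof -
  obtain x where x: "u = x @ [0]" "x = [] \<or> last x = 0"
    using run_decomp[OF assms(1)] assms(2) by auto
  with assms(3) have "x = butlast x @ [0]"
    by (metis append.left_neutral append_butlast_last_id)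
  with x that show ?thesis by (metis append.assoc append_Cons append_Nil)
qed

lemma defect_ge_positive_entries:
  "dyck (w @ [0, 0]) \<Longrightarrow> length (filter (\<lambda>x. 0 < x) w) \<le> defect (w @ [0, 0])"
proof (induction w)
  case (Cons a w)
  have "two_zeros (w @ [0, 0])" by (simp add: two_zeros_def butlast_append)
  then have "1 \<le> cost a (w @ [0, 0])" if "0 < a"
    using Cons.prems cost_pos_two_zeros[of a "w @ [0, 0]"] that by simp
  with Cons show ?case using dyck_ConsD by fastforce
qed simp

lemma length_eq_zeros_positive: "length w = count_list w 0 + length (filter (\<lambda>x. 0 < x) (w :: nat list))"
  by (induction w) auto

lemma defect_ge_positive_head:
  assumes "dyck (a # w @ [0, 0])" "1 \<le> a"
  shows "length w + 1 \<le> defect (a # w @ [0, 0])"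
  using defect_ge_positive_entries[of w] dyck_ConsD[OF assms(1)] cost_ge_zeros[OF assms]
    length_eq_zeros_positive[of w] by simp

lemma length_le_defect_run_1:
  assumes "dyck u" "run u = 1" "1 \<le> hd u \<or> (\<exists>x\<in>set u. 2 \<le> x)"
  shows "length u \<le> defect u + 2"
proof -
  have "u \<noteq> [0]" using assms(3) by auto
  then obtain w where w: "u = w @ [0, 0]"
    using run_1_decomp assms by blast
  show ?thesis
    using assms(3)
  proof
    assume "1 \<le> hd u"
    with w obtain a w' where "w = a # w'" "1 \<le> a" by (cases w) auto
    then show ?thesis using defect_ge_positive_head[of a w'] assms(1) w by simp
  next
    assume "\<exists>x\<in>set u. 2 \<le> x"
    then obtain x where x: "2 \<le> x" "x \<in> set w" using w by auto
    then obtain y z where "w = y @ x # z" by (auto simp: in_set_conv_decomp)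
    with w have u: "u = y @ (x # z @ [0, 0])" by simp
    have d: "dyck (x # z @ [0, 0])" using assms(1) u dyck_appendD by blast
    have "length y + defect (x # z @ [0, 0]) \<le> defect u"
      using defect_ge_late[of y "x # z @ [0, 0]" x] assms(1) u x
      by (simp add: two_zeros_def butlast_append)
    with defect_ge_positive_head[OF d] x u show ?thesis by simp
  qed
qed

text \<open>While there is a single 0 the high letters may be free, but the second 0 pays for all of
them at once, and each later high letter pays for itself.\<close>

lemma defect_ge_high:
  "dyck u \<Longrightarrow> two_zeros u \<Longrightarrow> high u \<le> defect u"
proof (induction u)
  case (Cons a u)
  then have ne: "u \<noteq> []" and d: "dyck u" using dyck_ConsD by auto
  show ?case
  proof (cases "two_zeros u")
    case True
    then show ?thesis
      using Cons.IH[OF d] cost_pos_two_zeros[OF Cons.prems(1)] by (cases "2 \<le> a") auto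
  next
    case False
    then show ?thesis using Cons.prems ne cost_0[of u] by auto
  qed
qed simp

lemma run_pos: "dyck u \<Longrightarrow> u \<noteq> [] \<Longrightarrow> 1 \<le> run u"
  using run_decomp[of u] by (cases "run u") auto

text \<open>If the head is at least 2, it pays for all zeros and ones but two, and by the previous
bound the rest of the word pays for its high letters. Otherwise the run is 1 and the head is
positive.\<close>

lemma length_le_defect_start:
  assumes "dyck u" "two_zeros u" "run u \<le> hd u"
  shows "length u \<le> defect u + 3"
proof (cases "2 \<le> hd u")
  case False
  have "u \<noteq> []" using assms by auto
  then have "run u = 1 \<and> 1 \<le> hd u" using run_pos assms False by fastforce
  then show ?thesis using length_le_defect_run_1 assms by fastforce
next
  case True
  obtain a v where u: "u = a # v" using assms by (cases u) auto
  then have "v \<noteq> []" using assms by auto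
  then have "two_zeros v" using assms True u by simp
  then show ?thesis
    using assms True u defect_ge_high[of v] cost_ge_low[of a v] dyck_ConsD[of a v]
      length_eq_low_high[of v] by simp
qed

lemma defect_ge_ones:
  "dyck (w @ [3, 2, 1, 0]) \<Longrightarrow> length (filter (\<lambda>x. x = 1) w) \<le> defect (w @ [3, 2, 1, 0])"
proof (induction w)
  case (Cons a w)
  then have "1 \<le> cost a (w @ [3, 2, 1, 0])" if "a = 1"
    using cost_pos_high[of a "w @ [3, 2, 1, 0]" 3] that by simp
  with Cons show ?case using dyck_ConsD by fastforce
qed simp

text \<open>Here the word begins with \<open>0, 1, 2, 3\<close>, as every dead end does. Up to its second 0 all
letters 1 but the first pay because of the 3; the second 0 pays for the high letters before it;
everything later pays by \<open>defect_ge_late\<close>.\<close>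

lemma length_le_defect_end:
  assumes "dyck u" "two_zeros u" "4 \<le> run u"
  shows "length u \<le> defect u + 3"
proof -
  obtain x where x: "u = x @ stair (run u)" using run_decomp assms by blast
  obtain y where "stair (run u) = y @ stair 4" using stair_split assms by blast
  with x have u: "u = (x @ y) @ [3, 2, 1, 0]" by (simp add: numeral_eq_Suc)
  define w where "w = x @ y"
  have "0 \<in> set w"
    using assms(2) u by (auto simp: two_zeros_def butlast_append w_def)
  then obtain l r where w: "w = l @ 0 # r" "0 \<notin> set r"
    by (metis split_list_last)
  let ?s = "r @ [3, 2, 1, 0]"
  have u': "u = l @ (0 # ?s)" using u w w_def by simp
  then have d: "dyck (0 # ?s)" using assms(1) dyck_appendD by blast
  have "count_list r 0 = 0" using w by (simp add: count_list_0_iff)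
  then have "length r = length (filter (\<lambda>x. x = 1) r) + high r"
    by (induction r) (auto split: if_splits)
  then have "length r + 2 \<le> defect (0 # ?s)"
    using defect_ge_ones[of r] dyck_ConsD[OF d] cost_0[OF d] by simp
  moreover have "length l + defect (0 # ?s) \<le> defect u"
    using defect_ge_late[of l "0 # ?s" 3] assms(1) u' by simp
  ultimately show ?thesis using u' by simp
qed

section \<open>Words with a single zero\<close>

text \<open>In terms of partitions, the same partition seen inside the next larger staircase.\<close>

definition shift :: "nat list \<Rightarrow> nat list" where
  "shift u = map Suc u @ [0]"

lemma shift_simps [simp]: "shift [] = [0]" "shift (a # u) = Suc a # shift u"
  by (auto simp: shift_def)

lemma shift_ne [simp]: "shift u \<noteq> []" and length_shift [simp]: "length (shift u) = Suc (length u)"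
  by (auto simp: shift_def)

lemma hd_shift: "u \<noteq> [] \<Longrightarrow> hd (shift u) = Suc (hd u)"
  by (cases u) auto

lemma dyck_shift [simp]: "dyck (shift u) \<longleftrightarrow> dyck u"
  by (induction u rule: dyck.induct) auto

lemma links_shift [simp]: "links (Suc a) (shift u) = links a u"
  by (induction u) auto

lemma winv_shift [simp]: "winv (shift u) = winv u"
  by (induction u) auto

lemma defect_shift [simp]: "defect (shift u) = defect u"
  by (induction u) (auto simp: cost_def)

lemma run_shift [simp]: "run (shift u) = Suc (run u)"
  by (induction u) auto

lemma inj_shift: "inj shift"
  by (auto simp: inj_def shift_def dest: map_injective)

lemma one_zero_words:
  "{u \<in> words (Suc n) k. \<not> two_zeros u} = shift ` words n k"
proof (intro equalityI subsetI)
  fix u assume u: "u \<in> {u \<in> words (Suc n) k. \<not> two_zeros u}"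
  then have "u = butlast u @ [0]" and "0 \<notin> set (butlast u)"
    using dyck_last[of u] append_butlast_last_id[of u]
    by (cases "u = []"; auto simp: words_def two_zeros_def)+
  moreover have "butlast u = map Suc (map (\<lambda>x. x - 1) (butlast u))"
  proof -
    have "Suc (x - 1) = x" if "x \<in> set (butlast u)" for x
    proof -
      have "x \<noteq> 0" using that u by (intro notI) (simp add: two_zeros_def)
      then show ?thesis by simp
    qed
    then show ?thesis by (auto intro!: map_idI [symmetric] simp del: Suc_diff_1 One_nat_def)
  qed
  ultimately have "u = shift (map (\<lambda>x. x - 1) (butlast u))"
    unfolding shift_def by metis
  then obtain v where "u = shift v" by blast
  with u show "u \<in> shift ` words n k" by (auto simp: words_def)
next
  fix u assume "u \<in> shift ` words n k"
  then show "u \<in> {u \<in> words (Suc n) k. \<not> two_zeros u}"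
    by (auto simp: words_def two_zeros_def) (auto simp: shift_def)
qed

lemma card_split_two_zeros:
  "card {u \<in> words (Suc n) k. P u} =
   card {u \<in> words (Suc n) k. two_zeros u \<and> P u} + card {u \<in> words n k. P (shift u)}"
proof -
  have "{u \<in> words (Suc n) k. P u} =
      {u \<in> words (Suc n) k. two_zeros u \<and> P u} \<union> {u \<in> shift ` words n k. P u}"
    unfolding one_zero_words[symmetric] by auto
  moreover have "card {u \<in> shift ` words n k. P u} = card {u \<in> words n k. P (shift u)}"
    unfolding Compr_image_eq by (rule card_image) (meson inj_on_subset inj_shift subset_UNIV)
  moreover have "card ({u \<in> words (Suc n) k. two_zeros u \<and> P u} \<union> {u \<in> shift ` words n k. P u}) =
      card {u \<in> words (Suc n) k. two_zeros u \<and> P u} + card {u \<in> shift ` words n k. P u}"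
  proof (rule card_Un_disjoint)
    show "finite {u \<in> shift ` words n k. P u}" by simp
    show "{u \<in> words (Suc n) k. two_zeros u \<and> P u} \<inter> {u \<in> shift ` words n k. P u} = {}"
      unfolding one_zero_words[symmetric] by auto
  qed simp
  ultimately show ?thesis by simp
qed

section \<open>Starts and ends of chains\<close>

definition start :: "nat list \<Rightarrow> bool" where
  "start u \<longleftrightarrow> run u = length u \<or> run u \<le> hd u"

definition dead_end :: "nat list \<Rightarrow> bool" where
  "dead_end u \<longleftrightarrow> hd u + 3 < run u"

text \<open>The third kind of words are also ends of chains, but they are counted by area, that is, at
the reflected value of \<open>winv\<close>. The successor in the second term expresses that a dead end at \<open>d -
1\<close> followed by a start at \<open>d\<close> continues the count of words as an unbroken chain would.\<close>

definition balanced :: "nat \<Rightarrow> nat \<Rightarrow> bool" where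
  "balanced n k \<longleftrightarrow> (\<forall>d.
     card {u \<in> words n k. start u \<and> winv u = d} =
     card {u \<in> words n k. dead_end u \<and> Suc (winv u) = d} +
     card {u \<in> words n k. run u = 1 \<and> sum_list u = d})"

text \<open>The difference of the balance identities at lengths \<open>n + 1\<close> and \<open>n\<close>; the words of length \<open>n
+ 1\<close> with a single zero have dropped out, being shifts of words of length \<open>n\<close>.\<close>

definition balanced_step :: "nat \<Rightarrow> nat \<Rightarrow> bool" where
  "balanced_step n k \<longleftrightarrow> (\<forall>d.
     card {u \<in> words (Suc n) k. two_zeros u \<and> start u \<and> winv u = d} +
     card {u \<in> words n k. run u = 1 \<and> sum_list u = d} =
     card {u \<in> words (Suc n) k. two_zeros u \<and> dead_end u \<and> Suc (winv u) = d} +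
     card {u \<in> words (Suc n) k. run u = 1 \<and> sum_list u = d})"

lemma balanced_Suc:
  assumes "1 \<le> n" "balanced n k" "balanced_step n k"
  shows "balanced (Suc n) k"
  unfolding balanced_def
proof
  fix d
  have ne: "u \<noteq> []" if "u \<in> words n k" for u
    using that assms(1) by (auto simp: words_def)
  have "{u \<in> words n k. start (shift u) \<and> winv (shift u) = d} = {u \<in> words n k. start u \<and> winv u = d}"
    using ne by (auto simp: start_def hd_shift)
  moreover have "{u \<in> words n k. dead_end (shift u) \<and> Suc (winv (shift u)) = d} =
      {u \<in> words n k. dead_end u \<and> Suc (winv u) = d}"
    using ne by (auto simp: dead_end_def hd_shift)
  ultimately show "card {u \<in> words (Suc n) k. start u \<and> winv u = d} =
     card {u \<in> words (Suc n) k. dead_end u \<and> Suc (winv u) = d} +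
     card {u \<in> words (Suc n) k. run u = 1 \<and> sum_list u = d}"
    using assms(2,3)
      card_split_two_zeros[of n k "\<lambda>u. start u \<and> winv u = d"]
      card_split_two_zeros[of n k "\<lambda>u. dead_end u \<and> Suc (winv u) = d"]
    unfolding balanced_def balanced_step_def by simp
qed

lemma balanced_1: "balanced 1 k"
proof -
  have w: "words 1 k = (if k = 0 then {[0]} else {})"
    by (auto simp: words_def length_Suc_conv cost_def)
  have c: "card {u. u = [0::nat] \<and> P u} = (if P [0] then 1 else 0)" for P
    by (simp add: Collect_conv_if)
  show ?thesis
    unfolding balanced_def w by (auto simp: c start_def dead_end_def)
qed

lemma not_two_zeros_if_full:
  assumes "dyck u" "run u = length u"
  shows "\<not> two_zeros u"
proof -
  obtain x where x: "u = x @ stair (length u)"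
    using run_decomp[of u] assms by auto
  then have "length u = length x + length u" by (metis length_append length_stair)
  with x have "u = stair (length u)" by simp
  moreover have "\<not> two_zeros (stair m)" for m
  proof (induction m)
    case (Suc m)
    then show ?case by (cases m) auto
  qed simp
  ultimately show ?thesis by metis
qed

text \<open>The words with two zeros are excluded by their defect. For the words of run 1 the same kind
of bound leaves only the letters 0 and 1 and a head 0, so that consing a further 0, which then
costs nothing, is a bijection.\<close>

lemma balanced_step_large:
  assumes "k + 3 \<le> n"
  shows "balanced_step n k"
  unfolding balanced_step_def
proof
  fix d
  have 1: "{u \<in> words (Suc n) k. two_zeros u \<and> start u \<and> winv u = d} = {}"
  proof -
    have False if w: "u \<in> words (Suc n) k" "two_zeros u" "start u" for u
    proof -
      have "run u \<noteq> length u" using w not_two_zeros_if_full by (auto simp: words_def)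
      then show False
        using length_le_defect_start[of u] w assms by (auto simp: words_def start_def)
    qed
    then show ?thesis by blast
  qed
  have 2: "{u \<in> words (Suc n) k. two_zeros u \<and> dead_end u \<and> Suc (winv u) = d} = {}"
    using length_le_defect_end assms by (fastforce simp: words_def dead_end_def)
  have "{u \<in> words (Suc n) k. run u = 1 \<and> sum_list u = d} =
      (#) 0 ` {u \<in> words n k. run u = 1 \<and> sum_list u = d}" (is "?A = _ ` ?B")
  proof (intro equalityI subsetI)
    fix u assume u: "u \<in> ?A"
    then obtain a v where v: "u = a # v" by (cases u) (auto simp: words_def)
    then have d: "dyck v" "length v = n" using u dyck_ConsD by (auto simp: words_def)
    \<comment> \<open>length \<open>n + 1\<close> would force the defect up to \<open>n - 1\<close>\<close>
    have "\<not> (1 \<le> hd u \<or> (\<exists>x\<in>set u. 2 \<le> x))"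
      using length_le_defect_run_1[of u] u assms by (auto simp: words_def)
    then have "a = 0" "high v = 0" using v by (auto simp: filter_empty_conv)
    then show "u \<in> (#) 0 ` ?B"
      using u v d cost_0[of v] assms by (auto simp: words_def split: if_splits)
  next
    fix u assume "u \<in> (#) 0 ` ?B"
    then obtain v where v: "u = 0 # v" "v \<in> ?B" by auto
    then have "\<not> (1 \<le> hd v \<or> (\<exists>x\<in>set v. 2 \<le> x))"
      using length_le_defect_run_1[of v] assms by (auto simp: words_def)
    then have "high v = 0" by (auto simp: filter_empty_conv)
    moreover have "v \<noteq> []" "dyck v" using v assms by (auto simp: words_def)
    then have "dyck (0 # v)" by (simp add: dyck_Cons_iff)
    ultimately show "u \<in> ?A"
      using v cost_0[of v] assms by (auto simp: words_def)
  qed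
  then have "card ?A = card ?B" by (simp add: card_image)
  then show "card {u \<in> words (Suc n) k. two_zeros u \<and> start u \<and> winv u = d} + card ?B =
     card {u \<in> words (Suc n) k. two_zeros u \<and> dead_end u \<and> Suc (winv u) = d} + card ?A"
    unfolding 1 2 by simp
qed

section \<open>From balance to symmetry\<close>

lemma card_words_split:
  assumes "\<And>u. u \<in> words n k \<Longrightarrow> P u \<longleftrightarrow> Q u \<or> R u"
    and "\<And>u. u \<in> words n k \<Longrightarrow> \<not> (Q u \<and> R u)"
  shows "card {u \<in> words n k. P u} = card {u \<in> words n k. Q u} + card {u \<in> words n k. R u}"
proof -
  have "{u \<in> words n k. P u} = {u \<in> words n k. Q u} \<union> {u \<in> words n k. R u}"
    using assms(1) by blast
  then show ?thesis
    using assms(2) by (simp add: card_Un_disjoint disjoint_iff)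
qed

text \<open>Words that are not ends and words that are not starts correspond under the chain step.
Comparing the two counts, balance cancels the dead ends.\<close>

lemma card_winv_recurrence:
  assumes n: "1 \<le> n" and bal: "balanced n k" and d: "d + e + k = n choose 2"
  shows "card {u \<in> words n k. winv u = Suc d} + card {u \<in> words n k. run u = 1 \<and> sum_list u = e} =
    card {u \<in> words n k. winv u = d} + card {u \<in> words n k. run u = 1 \<and> sum_list u = Suc d}"
proof -
  let ?W = "words n k"
  have pos: "1 \<le> run u \<and> u \<noteq> [] \<and> run u \<le> length u" if "u \<in> ?W" for u
  proof -
    have "u \<noteq> []" using that n by (auto simp: words_def)
    then show ?thesis using that run_pos[of u] run_le[of u] by (auto simp: words_def)
  qed
  have area: "winv u = d \<longleftrightarrow> sum_list u = e" if "u \<in> ?W" for u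
    using that winv_defect_area[of u] d by (auto simp: words_def)
  have "card {u \<in> ?W. winv u = d} = card {u \<in> ?W. (2 \<le> run u \<and> run u \<le> hd u + 3) \<and> winv u = d} +
      card {u \<in> ?W. (dead_end u \<or> run u = 1) \<and> winv u = d}"
    by (rule card_words_split) (use pos in \<open>fastforce simp: dead_end_def\<close>)+
  moreover have "card {u \<in> ?W. (dead_end u \<or> run u = 1) \<and> winv u = d} =
      card {u \<in> ?W. dead_end u \<and> Suc (winv u) = Suc d} + card {u \<in> ?W. run u = 1 \<and> sum_list u = e}"
    by (rule card_words_split) (use area in \<open>auto simp: dead_end_def\<close>)
  moreover have "card {u \<in> ?W. winv u = Suc d} =
      card {u \<in> ?W. (run u < length u \<and> hd u < run u) \<and> winv u = Suc d} +
      card {u \<in> ?W. start u \<and> winv u = Suc d}"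
    by (rule card_words_split) (use pos in \<open>fastforce simp: start_def\<close>)+
  moreover have "card {u \<in> ?W. start u \<and> winv u = Suc d} =
     card {u \<in> ?W. dead_end u \<and> Suc (winv u) = Suc d} +
     card {u \<in> ?W. run u = 1 \<and> sum_list u = Suc d}"
    using bal by (simp add: balanced_def)
  ultimately show ?thesis
    using card_sources_eq_card_targets[of n k d] by linarith
qed

text \<open>The recurrence says that \<open>p d - p (m - d)\<close> does not depend on \<open>d\<close>, and this expression is
also antisymmetric under \<open>d \<mapsto> m - d\<close>.\<close>

lemma reflection_symmetric:
  fixes p z :: "nat \<Rightarrow> nat"
  assumes rec: "\<And>d e. d + e = m \<Longrightarrow> p (Suc d) + z e = p d + z (Suc d)"
    and "d + e = m"
  shows "p d = p e"
proof -
  define q where "q d = int (p d) - int (p (m - d))" for d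
  have "q (Suc d) = q d" if "Suc d \<le> m" for d
  proof -
    have "p (Suc d) + z (m - d) = p d + z (Suc d)"
      using rec[of d "m - d"] that by simp
    moreover have "p (m - d) + z (Suc d) = p (m - Suc d) + z (m - d)"
      using rec[of "m - Suc d" "Suc d"] that by (simp add: Suc_diff_Suc)
    ultimately show ?thesis unfolding q_def by linarith
  qed
  then have const: "q d = q 0" if "d \<le> m" for d
    using that by (induction d) auto
  have "d \<le> m" "e \<le> m" using assms(2) by auto
  then have "q d = q e" using const by metis
  moreover have "q d = int (p d) - int (p e)" "q e = int (p e) - int (p d)"
    using assms(2) unfolding q_def by auto
  ultimately show ?thesis by linarith
qed

lemma card_winv_symmetric:
  assumes "1 \<le> n" "balanced n k" "d + e + k = n choose 2"
  shows "card {u \<in> words n k. winv u = d} = card {u \<in> words n k. winv u = e}"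
proof (rule reflection_symmetric[where p = "\<lambda>x. card {u \<in> words n k. winv u = x}" and z = "\<lambda>x. card {u \<in> words n k. run u = 1 \<and> sum_list u = x}" and m = "d + e"])
  fix a b assume "a + b = d + e"
  with assms(3) have "a + b + k = n choose 2" by simp
  then show "card {u \<in> words n k. winv u = Suc a} + card {u \<in> words n k. run u = 1 \<and> sum_list u = b} =
    card {u \<in> words n k. winv u = a} + card {u \<in> words n k. run u = 1 \<and> sum_list u = Suc a}"
    by (rule card_winv_recurrence[OF assms(1,2)])
qed simp

section \<open>Checking short words by exhaustive search\<close>

text \<open>The discrepancy in \<open>balanced_step\<close>, as a function of length, defect and the statistic \<open>d\<close>,
is collected in a finite signed tally: an association list from keys \<open>[length, defect, d]\<close> to
multiplicities. Tallies are kept sorted and without zero entries so that cancelling contributions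
disappear as early as possible; correctness does not depend on the order.

The search is evaluated by rewriting. Case distinctions are therefore made by auxiliary functions
on truth values: no branch is rewritten before its condition is known.\<close>

type_synonym tally = "(nat list \<times> int) list"

datatype ordering = Less | Equal | Greater

fun compare :: "nat list \<Rightarrow> nat list \<Rightarrow> ordering" where
  "compare [] [] = Equal"
| "compare [] (b # l) = Less"
| "compare (a # k) [] = Greater"
| "compare (0 # k) (0 # l) = compare k l"
| "compare (0 # k) (Suc b # l) = Less"
| "compare (Suc a # k) (0 # l) = Greater"
| "compare (Suc a # k) (Suc b # l) = compare (a # k) (b # l)"

fun cons_nonzero :: "bool \<Rightarrow> nat list \<Rightarrow> int \<Rightarrow> tally \<Rightarrow> tally" where
  "cons_nonzero True k c p = p"
| "cons_nonzero False k c p = (k, c) # p"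

function (sequential) add :: "tally \<Rightarrow> tally \<Rightarrow> tally"
  and merge :: "ordering \<Rightarrow> nat list \<Rightarrow> int \<Rightarrow> tally \<Rightarrow> nat list \<Rightarrow> int \<Rightarrow> tally \<Rightarrow> tally" where
  "add [] q = q"
| "add (x # p) [] = x # p"
| "add ((k, c) # p) ((l, d) # q) = merge (compare k l) k c p l d q"
| "merge Less k c p l d q = (k, c) # add p ((l, d) # q)"
| "merge Greater k c p l d q = (l, d) # add ((k, c) # p) q"
| "merge Equal k c p l d q = cons_nonzero (c + d = 0) k (c + d) (add p q)"
  by pat_completeness auto
termination
  by (relation "measure (\<lambda>s. case s of Inl (p, q) \<Rightarrow> 2 * (length p + length q)
      | Inr (_, _, _, p, _, _, q) \<Rightarrow> 2 * (length p + length q) + 3)") auto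

primrec coef :: "nat list \<Rightarrow> tally \<Rightarrow> int" where
  "coef l [] = 0"
| "coef l (x # p) = (if fst x = l then snd x else 0) + coef l p"

fun indicator_tally :: "bool \<Rightarrow> nat list \<Rightarrow> int \<Rightarrow> tally" where
  "indicator_tally True k c = [(k, c)]"
| "indicator_tally False k c = []"

primrec heads :: "nat list \<Rightarrow> nat list" where
  "heads [] = [0]"
| "heads (b # u) = stair (Suc (Suc b))"

fun bump :: "bool \<Rightarrow> bool \<Rightarrow> nat \<Rightarrow> nat" where
  "bump True b l = Suc l"
| "bump False True l = Suc l"
| "bump False False l = l"

lemma links_code [code]:
  "links a [] = 0"
  "links a (x # u) = bump (x = a) (x = Suc a) (links a u)"
  by auto

fun next_run :: "bool \<Rightarrow> bool \<Rightarrow> nat \<Rightarrow> nat \<Rightarrow> nat" where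
  "next_run True True n r = Suc n"
| "next_run True False n r = r"
| "next_run False b n r = r"

fun count_high :: "nat list \<Rightarrow> nat" where
  "count_high [] = 0"
| "count_high (0 # u) = count_high u"
| "count_high (Suc 0 # u) = count_high u"
| "count_high (Suc (Suc a) # u) = Suc (count_high u)"

fun in_bound :: "bool \<Rightarrow> bool \<Rightarrow> nat \<Rightarrow> nat list \<Rightarrow> bool" where
  "in_bound False z e u = False"
| "in_bound True True e u = True"
| "in_bound True False e u = (e + count_high u \<le> 11)"

fun end_tally :: "bool \<Rightarrow> nat \<Rightarrow> nat list \<Rightarrow> nat \<Rightarrow> nat \<Rightarrow> nat \<Rightarrow> tally" where
  "end_tally False n u e v r = []"
| "end_tally True n u e v r =
     add (indicator_tally (r \<le> hd u) [n, e, v] 1) (indicator_tally (hd u + 3 < r) [n, e, Suc v] (-1))"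

definition local_tally :: "nat \<Rightarrow> nat list \<Rightarrow> nat \<Rightarrow> nat \<Rightarrow> nat \<Rightarrow> bool \<Rightarrow> tally" where
  "local_tally n u e v r z =
     add (indicator_tally (r = 1) [n, e, sum_list u] (-1)) (end_tally z n u e v r)"

text \<open>The arguments of a search are the length, the word, its defect, its \<open>winv\<close>, its run, and
whether it has two zeros.\<close>

type_synonym search = "nat \<Rightarrow> nat list \<Rightarrow> nat \<Rightarrow> nat \<Rightarrow> nat \<Rightarrow> bool \<Rightarrow> tally"

fun guarded :: "search \<Rightarrow> bool \<Rightarrow> search" where
  "guarded f True n u e v r z = f n u e v r z"
| "guarded f False n u e v r z = []"

definition enter :: "search \<Rightarrow> search" where
  "enter f n u e v r z = guarded f (in_bound (e \<le> 11) z e u) n u e v r z"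

definition child :: "search \<Rightarrow> nat \<Rightarrow> nat \<Rightarrow> nat list \<Rightarrow> nat \<Rightarrow> nat \<Rightarrow> nat \<Rightarrow> nat \<Rightarrow> bool \<Rightarrow> tally" where
  "child f a n u e g v r z =
     enter f (Suc n) (a # u) (e + (n - a - g)) (g + v) (next_run (r = n) (a = n) n r) (a = 0 \<or> z)"

primrec children :: "nat list \<Rightarrow> search \<Rightarrow> search" where
  "children [] f n u e v r z = []"
| "children (a # as) f n u e v r z =
     add (child f a n u e (links a u) v r z) (children as f n u e v r z)"

text \<open>The second summand is the contribution of a run-1 word to the identity for the next length.
It is left out at depth 0, where no longer words are visited.\<close>

primrec search :: "nat \<Rightarrow> search" where
  "search 0 n u e v r z = local_tally n u e v r z"
| "search (Suc m) n u e v r z =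
     add (local_tally n u e v r z)
       (add (indicator_tally (r = 1) [Suc n, e, sum_list u] 1) (children (heads u) (search m) n u e v r z))"

lemma compare_Equal: "compare k l = Equal \<Longrightarrow> k = l"
  by (induction k l rule: compare.induct) auto

lemma coef_cons_nonzero: "b = (c = 0) \<Longrightarrow> coef l (cons_nonzero b k c p) = (if k = l then c else 0) + coef l p"
  by (cases b) auto

lemma coef_add_merge:
  "coef x (add p q) = coef x p + coef x q"
  "(ord = Equal \<longrightarrow> k = l) \<Longrightarrow>
     coef x (merge ord k c p l d q) = coef x ((k, c) # p) + coef x ((l, d) # q)"
proof (induction p q and ord k c p l d q rule: add_merge.induct)
  case (3 k c p l d q)
  then show ?case using compare_Equal by (simp del: coef.simps)
next
  case (6 k c p l d q)
  then show ?case by (simp add: coef_cons_nonzero)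
qed simp_all

lemma coef_add [simp]: "coef x (add p q) = coef x p + coef x q"
  by (rule coef_add_merge)

lemma coef_indicator_tally [simp]: "coef x (indicator_tally b k c) = (if b \<and> k = x then c else 0)"
  by (cases b) auto

lemma count_high: "count_high u = high u"
  by (induction u rule: count_high.induct) auto

text \<open>Pruning by the defect alone would keep many words with a single 0, which matter only as
prefixes of words with two zeros. Adding the price that the second 0 will have to pay keeps the
bound monotone along extensions and agrees with the defect as soon as there are two zeros.\<close>

definition admissible :: "nat list \<Rightarrow> bool" where
  "admissible u \<longleftrightarrow> defect u + (if two_zeros u then 0 else high u) \<le> 11"

lemma in_bound_iff: "in_bound (defect u \<le> 11) (two_zeros u) (defect u) u \<longleftrightarrow> admissible u"
  by (cases "defect u \<le> 11"; cases "two_zeros u") (auto simp: admissible_def count_high)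

lemma admissible_ConsD:
  assumes "dyck (a # u)" "admissible (a # u)"
  shows "admissible u"
proof (cases "u = []")
  case False
  then show ?thesis
    using assms cost_0[of u] by (cases "a = 0") (auto simp: admissible_def split: if_splits)
qed (simp add: admissible_def)

lemma admissible_appendD:
  "dyck (y @ u) \<Longrightarrow> admissible (y @ u) \<Longrightarrow> admissible u"
  by (induction y) (auto dest: dyck_ConsD admissible_ConsD)

lemma set_heads: "a \<in> set (heads u) \<longleftrightarrow> (if u = [] then a = 0 else a \<le> Suc (hd u))"
  by (cases u) (auto simp: less_Suc_eq_le)

lemma distinct_heads: "distinct (heads u)"
proof -
  have "distinct (stair k)" for k by (induction k) auto
  then show ?thesis by (cases u) (auto simp del: stair.simps)
qed

definition extensions :: "nat \<Rightarrow> nat list \<Rightarrow> nat list set" where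
  "extensions m u = {w. (\<exists>y. w = y @ u \<and> length y \<le> m) \<and> dyck w \<and> admissible w}"

lemma extensions_0: "dyck u \<Longrightarrow> admissible u \<Longrightarrow> extensions 0 u = {u}"
  by (auto simp: extensions_def)

lemma extensions_empty: "\<not> (dyck u \<and> admissible u) \<Longrightarrow> extensions m u = {}"
  by (auto simp: extensions_def dest: dyck_appendD admissible_appendD)

lemma extensions_Suc:
  assumes "dyck u" "admissible u" "u \<noteq> []"
  shows "extensions (Suc m) u = insert u (\<Union>a\<in>set (heads u). extensions m (a # u))"
proof (intro equalityI subsetI)
  fix w assume "w \<in> extensions (Suc m) u"
  then obtain y where y: "w = y @ u" "length y \<le> Suc m" "dyck w" "admissible w"
    by (auto simp: extensions_def)
  show "w \<in> insert u (\<Union>a\<in>set (heads u). extensions m (a # u))"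
  proof (cases y rule: rev_cases)
    case (snoc y' a)
    then have "a \<in> set (heads u)"
      using y assms dyck_appendD[of y' "a # u"] by (auto simp: set_heads dyck_Cons_iff)
    then show ?thesis using y snoc by (auto simp: extensions_def)
  qed (use y in auto)
next
  fix w assume "w \<in> insert u (\<Union>a\<in>set (heads u). extensions m (a # u))"
  then show "w \<in> extensions (Suc m) u"
  proof
    assume "w \<in> (\<Union>a\<in>set (heads u). extensions m (a # u))"
    then obtain a y where "w = y @ a # u" "length y \<le> m" "dyck w" "admissible w"
      by (auto simp: extensions_def)
    then show ?thesis unfolding extensions_def by (intro CollectI conjI exI[of _ "y @ [a]"]) auto
  qed (use assms in \<open>auto simp: extensions_def\<close>)
qed

lemma finite_extensions: "finite (extensions m u)"
proof (rule finite_subset)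
  show "extensions m u \<subseteq> (\<Union>n\<le>m + length u. {w. dyck w \<and> length w = n \<and> True})"
    by (auto simp: extensions_def)
  show "finite (\<Union>n\<le>m + length u. {w. dyck w \<and> length w = n \<and> True})"
    by (intro finite_UN_I finite_dyck) auto
qed

lemma extensions_disjoint:
  assumes "a \<noteq> b"
  shows "extensions m (a # u) \<inter> extensions m (b # u) = {}"
proof -
  have "y @ a # u \<noteq> y' @ b # u" for y y'
    using assms by (simp add: append_eq_append_conv)
  then show ?thesis by (auto simp: extensions_def)
qed

definition local_weight :: "nat list \<Rightarrow> nat list \<Rightarrow> int" where
  "local_weight x u =
     (if two_zeros u \<and> run u \<le> hd u \<and> [length u, defect u, winv u] = x then 1 else 0)
   - (if two_zeros u \<and> dead_end u \<and> [length u, defect u, Suc (winv u)] = x then 1 else 0)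
   - (if run u = 1 \<and> [length u, defect u, sum_list u] = x then 1 else 0)"

definition carry_weight :: "nat list \<Rightarrow> nat list \<Rightarrow> int" where
  "carry_weight x u = (if run u = 1 \<and> [Suc (length u), defect u, sum_list u] = x then 1 else 0)"

abbreviation search_word :: "nat \<Rightarrow> nat list \<Rightarrow> tally" where
  "search_word m u \<equiv> search m (length u) u (defect u) (winv u) (run u) (two_zeros u)"

lemma coef_local_tally:
  "coef x (local_tally (length u) u (defect u) (winv u) (run u) (two_zeros u)) = local_weight x u"
  by (cases "two_zeros u") (auto simp: local_tally_def local_weight_def dead_end_def)

lemma child_eq:
  assumes "u \<noteq> []"
  shows "child f a (length u) u (defect u) (links a u) (winv u) (run u) (two_zeros u) =
    (if admissible (a # u)
     then f (length (a # u)) (a # u) (defect (a # u)) (winv (a # u)) (run (a # u)) (two_zeros (a # u))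
     else [])"
proof -
  have r: "next_run (run u = length u) (a = length u) (length u) (run u) = run (a # u)"
    by (cases "run u = length u"; cases "a = length u") auto
  have "child f a (length u) u (defect u) (links a u) (winv u) (run u) (two_zeros u) =
      enter f (length (a # u)) (a # u) (defect (a # u)) (winv (a # u)) (run (a # u)) (two_zeros (a # u))"
    unfolding child_def r using assms by (simp add: cost_def add.commute)
  also have "\<dots> = (if admissible (a # u)
     then f (length (a # u)) (a # u) (defect (a # u)) (winv (a # u)) (run (a # u)) (two_zeros (a # u))
     else [])"
    unfolding enter_def in_bound_iff by (cases "admissible (a # u)") auto
  finally show ?thesis .
qed

lemma coef_children:
  assumes "u \<noteq> []"
  shows "coef x (children as (search m) (length u) u (defect u) (winv u) (run u) (two_zeros u)) =
    (\<Sum>a\<leftarrow>as. if admissible (a # u) then coef x (search_word m (a # u)) else 0)"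
  by (induction as) (auto simp: child_eq[OF assms] simp del: length_Cons defect.simps winv.simps run.simps)

lemma coef_search:
  assumes "dyck u" "admissible u" "u \<noteq> []"
  shows "coef x (search_word m u) =
    (\<Sum>w\<in>extensions m u. local_weight x w + (if length w < length u + m then carry_weight x w else 0))"
  using assms
proof (induction m arbitrary: u)
  case 0
  then show ?case by (simp add: extensions_0 coef_local_tally)
next
  case (Suc m)
  define W where "W w = local_weight x w + (if length w < length u + Suc m then carry_weight x w else 0)" for w
  have sub: "(if admissible (a # u) then coef x (search_word m (a # u)) else 0) = sum W (extensions m (a # u))"
    if "a \<in> set (heads u)" for a
  proof (cases "admissible (a # u)")
    case True
    have "dyck (a # u)" using that Suc.prems by (simp add: set_heads dyck_Cons_iff)
    then show ?thesis using True Suc.IH[of "a # u"] by (simp add: W_def)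
  qed (simp add: extensions_empty)
  have "coef x (search_word (Suc m) u) = W u +
      (\<Sum>a\<leftarrow>heads u. if admissible (a # u) then coef x (search_word m (a # u)) else 0)"
    by (simp add: coef_local_tally coef_children[OF Suc.prems(3)] W_def carry_weight_def)
  also have "(\<Sum>a\<leftarrow>heads u. if admissible (a # u) then coef x (search_word m (a # u)) else 0) =
      (\<Sum>a\<in>set (heads u). sum W (extensions m (a # u)))"
    unfolding sum_list_distinct_conv_sum_set[OF distinct_heads] by (rule sum.cong) (auto simp: sub)
  also have "\<dots> = sum W (\<Union>a\<in>set (heads u). extensions m (a # u))"
    by (rule sum.UNION_disjoint [symmetric]) (use finite_extensions extensions_disjoint in auto)
  also have "W u + \<dots> = sum W (extensions (Suc m) u)"
  proof -
    have "u \<notin> (\<Union>a\<in>set (heads u). extensions m (a # u))"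
      by (auto simp: extensions_def)
    then show ?thesis
      unfolding extensions_Suc[OF Suc.prems] using finite_extensions by simp
  qed
  finally show ?case unfolding W_def .
qed

text \<open>All contributions for lengths 2 to 14 cancel. The remaining entry belongs to the word \<open>[0]\<close>
itself, which enters the identity for the step from length 0 to length 1.\<close>

lemma search_value: "search 13 1 [0] 0 0 1 False = [([1, 0, 0], -1)]"
  by code_simp

text \<open>The coefficient of the key \<open>[Suc n, k, d]\<close> in the search result is the difference of the
two sides of the claim.\<close>

lemma balanced_step_small:
  assumes "k \<le> 11" "1 \<le> n" "n \<le> 13"
  shows "balanced_step n k"
  unfolding balanced_step_def
proof
  fix d
  let ?E = "extensions 13 [0]" and ?x = "[Suc n, k, d]"
  have E: "w \<in> ?E \<longleftrightarrow> dyck w \<and> admissible w \<and> w \<noteq> [] \<and> length w \<le> 14" for w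
  proof
    assume w: "dyck w \<and> admissible w \<and> w \<noteq> [] \<and> length w \<le> 14"
    then have "w = butlast w @ [0]" using dyck_last append_butlast_last_id by metis
    with w show "w \<in> ?E" unfolding extensions_def by (auto intro: exI[of _ "butlast w"])
  qed (auto simp: extensions_def)
  have adm: "admissible w" if "w \<in> words l k" "two_zeros w" for w l
    using that assms by (auto simp: admissible_def words_def)
  have adm1: "admissible w" if w: "w \<in> words l k" "run w = 1" for w l
  proof (cases "w = [0]")
    case False
    then obtain v where "w = v @ [0, 0]" using run_1_decomp[of w] w by (auto simp: words_def)
    then have "two_zeros w" by (simp add: two_zeros_def butlast_append)
    then show ?thesis using adm w by blast
  qed (simp add: admissible_def cost_def)
  have "0 = coef ?x (search_word 13 [0])"
    using search_value assms by (simp add: cost_def)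
  also have "\<dots> = (\<Sum>w\<in>?E. local_weight ?x w + (if length w < 14 then carry_weight ?x w else 0))"
    by (subst coef_search) (auto simp: admissible_def cost_def)
  also have "\<dots> =
      (\<Sum>w\<in>?E. if two_zeros w \<and> run w \<le> hd w \<and> [length w, defect w, winv w] = ?x then 1 else 0)
    - (\<Sum>w\<in>?E. if two_zeros w \<and> dead_end w \<and> [length w, defect w, Suc (winv w)] = ?x then 1 else 0)
    - (\<Sum>w\<in>?E. if run w = 1 \<and> [length w, defect w, sum_list w] = ?x then 1 else 0)
    + (\<Sum>w\<in>?E. if run w = 1 \<and> [Suc (length w), defect w, sum_list w] = ?x then 1 else 0)"
    unfolding sum_subtractf[symmetric] sum.distrib[symmetric]
    by (rule sum.cong) (use assms in \<open>auto simp: local_weight_def carry_weight_def\<close>)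
  also have "\<dots> =
      int (card {u \<in> words (Suc n) k. two_zeros u \<and> start u \<and> winv u = d})
    - int (card {u \<in> words (Suc n) k. two_zeros u \<and> dead_end u \<and> Suc (winv u) = d})
    - int (card {u \<in> words (Suc n) k. run u = 1 \<and> sum_list u = d})
    + int (card {u \<in> words n k. run u = 1 \<and> sum_list u = d})"
  proof -
    have ind: "(\<Sum>w\<in>?E. if P w then 1 else 0) = int (card {w \<in> ?E. P w})" for P
      using finite_extensions[of 13 "[0]"] by (simp add: sum.If_cases Int_def)
    have "{w \<in> ?E. two_zeros w \<and> run w \<le> hd w \<and> [length w, defect w, winv w] = ?x} =
        {u \<in> words (Suc n) k. two_zeros u \<and> start u \<and> winv u = d}"
      using assms adm not_two_zeros_if_full by (auto simp: E words_def start_def)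
    moreover have "{w \<in> ?E. two_zeros w \<and> dead_end w \<and> [length w, defect w, Suc (winv w)] = ?x} =
        {u \<in> words (Suc n) k. two_zeros u \<and> dead_end u \<and> Suc (winv u) = d}"
      using assms adm by (auto simp: E words_def)
    moreover have "{w \<in> ?E. run w = 1 \<and> [length w, defect w, sum_list w] = ?x} =
        {u \<in> words (Suc n) k. run u = 1 \<and> sum_list u = d}"
      using assms adm1 by (auto simp: E words_def)
    moreover have "{w \<in> ?E. run w = 1 \<and> [Suc (length w), defect w, sum_list w] = ?x} =
        {u \<in> words n k. run u = 1 \<and> sum_list u = d}"
      using assms adm1 by (auto simp: E words_def)
    ultimately show ?thesis unfolding ind by simp
  qed
  finally show "card {u \<in> words (Suc n) k. two_zeros u \<and> start u \<and> winv u = d} +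
     card {u \<in> words n k. run u = 1 \<and> sum_list u = d} =
     card {u \<in> words (Suc n) k. two_zeros u \<and> dead_end u \<and> Suc (winv u) = d} +
     card {u \<in> words (Suc n) k. run u = 1 \<and> sum_list u = d}"
    by linarith
qed

lemma balanced:
  assumes "k \<le> 11" "1 \<le> n"
  shows "balanced n k"
  using assms(2)
proof (induction n rule: dec_induct)
  case base
  show ?case by (rule balanced_1)
next
  case (step n)
  then have "balanced_step n k"
    using balanced_step_small balanced_step_large assms(1) by (cases "n \<le> 13") auto
  with step show ?case by (intro balanced_Suc) auto
qed

section \<open>Partitions as Dyck words\<close>

definition fits :: "nat \<Rightarrow> nat list \<Rightarrow> bool" where
  "fits n \<gamma> \<longleftrightarrow> (\<forall>i<length \<gamma>. \<gamma> ! i + Suc i \<le> n)"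

lemma fits_simps [simp]:
  "fits n []"
  "\<not> fits 0 (a # \<gamma>)"
  "fits (Suc n) (a # \<gamma>) \<longleftrightarrow> a \<le> n \<and> fits n \<gamma>"
proof -
  show "\<not> fits 0 (a # \<gamma>)" by (auto simp: fits_def)
  show "fits (Suc n) (a # \<gamma>) \<longleftrightarrow> a \<le> n \<and> fits n \<gamma>"
  proof
    assume f: "fits (Suc n) (a # \<gamma>)"
    have "\<gamma> ! i + Suc i \<le> n" if "i < length \<gamma>" for i
      using f[unfolded fits_def, rule_format, of "Suc i"] that by simp
    moreover have "a \<le> n" using f[unfolded fits_def, rule_format, of 0] by simp
    ultimately show "a \<le> n \<and> fits n \<gamma>" by (simp add: fits_def)
  next
    assume f: "a \<le> n \<and> fits n \<gamma>"
    show "fits (Suc n) (a # \<gamma>)"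
      unfolding fits_def
    proof (intro allI impI)
      fix i assume "i < length (a # \<gamma>)"
      with f show "(a # \<gamma>) ! i + Suc i \<le> Suc n" by (cases i) (auto simp: fits_def)
    qed
  qed
qed (simp add: fits_def)

lemma DP_iff_fits:
  assumes "1 \<le> n"
  shows "\<gamma> \<in> DP n \<longleftrightarrow> is_partition \<gamma> \<and> fits n \<gamma>"
proof
  assume "\<gamma> \<in> DP n"
  then show "is_partition \<gamma> \<and> fits n \<gamma>" using DP_part_le by (auto simp: DP_def fits_def)
next
  assume f: "is_partition \<gamma> \<and> fits n \<gamma>"
  have "int (part \<gamma> i) \<le> int n - int i" if "i \<in> {1..length \<gamma>}" for i
  proof -
    have "i - 1 < length \<gamma>" using that by auto
    then have "\<gamma> ! (i - 1) + Suc (i - 1) \<le> n" using f unfolding fits_def by blast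
    then show ?thesis using that by (simp add: part_def)
  qed
  then have "min_Delta \<gamma> \<le> n"
    unfolding min_Delta_def using assms by (intro Least_le) auto
  with f show "\<gamma> \<in> DP n" by (simp add: DP_def)
qed

lemma is_partition_simps [simp]:
  "is_partition []"
  "is_partition (a # \<gamma>) \<longleftrightarrow> 0 < a \<and> (\<forall>x\<in>set \<gamma>. x \<le> a) \<and> is_partition \<gamma>"
  by (auto simp: is_partition_def)

text \<open>Row \<open>i\<close> of the staircase of size \<open>n\<close> has \<open>n - i\<close> cells; the word records how many of them
are free, with empty rows of the partition giving the staircase at the bottom.\<close>

fun word_of :: "nat \<Rightarrow> nat list \<Rightarrow> nat list" where
  "word_of 0 \<gamma> = []"
| "word_of (Suc n) [] = n # word_of n []"
| "word_of (Suc n) (a # \<gamma>) = (n - a) # word_of n \<gamma>"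

fun partition_of :: "nat list \<Rightarrow> nat list" where
  "partition_of [] = []"
| "partition_of (a # u) = (if a = length u then [] else (length u - a) # partition_of u)"

lemma length_word_of [simp]: "length (word_of n \<gamma>) = n"
  by (induction n \<gamma> rule: word_of.induct) auto

lemma word_of_Nil [simp]: "word_of n [] = stair n"
  by (induction n) auto

lemma dyck_word_of: "is_partition \<gamma> \<Longrightarrow> fits n \<gamma> \<Longrightarrow> dyck (word_of n \<gamma>)"
proof (induction n \<gamma> rule: word_of.induct)
  case (3 n a \<gamma>)
  have "n - a \<le> Suc (hd (word_of n \<gamma>))" if ne: "n \<noteq> 0"
  proof -
    obtain m where m: "n = Suc m" using ne by (cases n) auto
    show ?thesis using 3 m by (cases \<gamma>) auto
  qed
  with 3 show ?case by (cases "n = 0") (auto simp: dyck_Cons_iff length_0_conv[symmetric] simp del: length_0_conv)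
next
  case (2 n)
  then show ?case using dyck_stair[of "Suc n"] by simp
qed simp

lemma sum_list_word_of: "fits n \<gamma> \<Longrightarrow> sum_list (word_of n \<gamma>) + sum_list \<gamma> = n choose 2"
proof (induction n \<gamma> rule: word_of.induct)
  case (1 \<gamma>)
  then show ?case by (cases \<gamma>) auto
qed (auto simp: numeral_2_eq_2)

lemma partition_of_word_of: "is_partition \<gamma> \<Longrightarrow> fits n \<gamma> \<Longrightarrow> partition_of (word_of n \<gamma>) = \<gamma>"
proof (induction n \<gamma> rule: word_of.induct)
  case (1 \<gamma>)
  then show ?case by (cases \<gamma>) auto
qed auto

lemma dyck_full: "dyck (a # u) \<Longrightarrow> a = length u \<Longrightarrow> u = stair (length u)"
proof (induction u arbitrary: a)
  case (Cons b u)
  then have "b < length (b # u)" using dyck_set_less[of "b # u"] by (auto dest: dyck_ConsD)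
  with Cons.prems have "b = length u" "dyck (b # u)" by auto
  with Cons.IH show ?case by auto
qed simp

lemma partition_of_dyck:
  "dyck u \<Longrightarrow> is_partition (partition_of u) \<and> fits (length u) (partition_of u) \<and>
     word_of (length u) (partition_of u) = u"
proof (induction u rule: partition_of.induct)
  case (2 a u)
  show ?case
  proof (cases "a = length u")
    case True
    then show ?thesis using dyck_full[OF 2(2)] by simp
  next
    case False
    have a: "a < length u" using dyck_set_less[OF 2(2)] False by auto
    then obtain b v where u: "u = b # v" by (cases u) auto
    have IH: "is_partition (partition_of u)" "fits (length u) (partition_of u)"
      "word_of (length u) (partition_of u) = u"
      using 2 False dyck_ConsD by blast+
    have "\<forall>x\<in>set (partition_of u). x \<le> length u - a"
      using IH(1) 2(2) by (auto simp: u split: if_splits)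
    then show ?thesis using IH a False by auto
  qed
qed simp

lemma bij_betw_word_of:
  assumes "1 \<le> n"
  shows "bij_betw (word_of n) (DP n) {u. dyck u \<and> length u = n}"
proof (rule bij_betw_byWitness[where f' = partition_of])
  show "\<forall>\<gamma>\<in>DP n. partition_of (word_of n \<gamma>) = \<gamma>"
    using partition_of_word_of DP_iff_fits[OF assms] by blast
  show "\<forall>u\<in>{u. dyck u \<and> length u = n}. word_of n (partition_of u) = u"
    using partition_of_dyck by blast
  show "word_of n ` DP n \<subseteq> {u. dyck u \<and> length u = n}"
    using dyck_word_of DP_iff_fits[OF assms] by auto
  show "partition_of ` {u. dyck u \<and> length u = n} \<subseteq> DP n"
    using partition_of_dyck DP_iff_fits[OF assms] by auto
qed

section \<open>The two forms of dinv\<close>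

lemma part_Cons [simp]: "part (a # \<gamma>) (Suc 0) = a" "1 \<le> i \<Longrightarrow> part (a # \<gamma>) (Suc i) = part \<gamma> i"
  by (auto simp: part_def nth_Cons')

lemma diagram_Cons:
  "diagram (a # \<gamma>) = {1} \<times> {1..a} \<union> (\<lambda>(i, j). (Suc i, j)) ` diagram \<gamma>"
proof (intro equalityI subrelI)
  fix i j assume ij: "(i, j) \<in> diagram (a # \<gamma>)"
  then obtain k where i: "i = Suc k" by (cases i) (auto simp: diagram_def)
  show "(i, j) \<in> {1} \<times> {1..a} \<union> (\<lambda>(i, j). (Suc i, j)) ` diagram \<gamma>"
  proof (cases "k = 0")
    case True
    then show ?thesis using ij i by (auto simp: diagram_def)
  next
    case False
    then have "(k, j) \<in> diagram \<gamma>" using ij i by (auto simp: diagram_def)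
    then show ?thesis using i by (auto intro: rev_image_eqI)
  qed
qed (auto simp: diagram_def)

lemma card_column:
  assumes "1 \<le> j"
  shows "card {i. (i, j) \<in> diagram \<gamma>} = length (filter (\<lambda>x. j \<le> x) \<gamma>) \<and> finite {i. (i, j) \<in> diagram \<gamma>}"
proof (induction \<gamma>)
  case (Cons a \<gamma>)
  have "{i. (i, j) \<in> diagram (a # \<gamma>)} = (if j \<le> a then {1} else {}) \<union> Suc ` {i. (i, j) \<in> diagram \<gamma>}"
    using assms by (auto simp: diagram_Cons)
  moreover have "1 \<notin> Suc ` {i. (i, j) \<in> diagram \<gamma>}"
    by (auto simp: diagram_def)
  ultimately show ?case using Cons by (auto simp: card_image)
qed (simp add: diagram_def)

lemma part_le_hd: "is_partition (a # \<gamma>) \<Longrightarrow> part (a # \<gamma>) i \<le> a"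
  by (auto simp: part_def nth_Cons' dest: nth_mem)

lemma part_map_upt: "1 \<le> j \<Longrightarrow> j \<le> m \<Longrightarrow> part (map f [1..<Suc m]) j = f j"
  by (simp add: part_def del: upt_Suc)

lemma leg_eq:
  assumes "is_partition \<gamma>" "(i, j) \<in> diagram \<gamma>"
  shows "leg \<gamma> (i, j) = int (length (filter (\<lambda>x. j \<le> x) \<gamma>)) - int i"
proof -
  obtain a \<rho> where \<gamma>: "\<gamma> = a # \<rho>" using assms(2) by (cases \<gamma>) (auto simp: diagram_def)
  have j: "1 \<le> j" "j \<le> part \<gamma> 1"
    using assms part_le_hd[of a \<rho> i] \<gamma> by (auto simp: diagram_def)
  then have "part (conjugate \<gamma>) j = card {i. (i, j) \<in> diagram \<gamma>}"
    unfolding conjugate_def by (rule part_map_upt)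
  then show ?thesis using card_column[OF j(1)] by (simp add: leg_def)
qed

definition row_dinv :: "nat \<Rightarrow> nat list \<Rightarrow> nat" where
  "row_dinv a \<gamma> = card {j \<in> {1..a}. int a - int j - int (length (filter (\<lambda>x. j \<le> x) \<gamma>)) \<in> {0, 1}}"

lemma dinv_Nil [simp]: "dinv [] = 0"
proof -
  have "diagram [] = {}" by (auto simp: diagram_def)
  then show ?thesis by (simp add: dinv_def)
qed

lemma dinv_Cons:
  assumes "is_partition (a # \<gamma>)"
  shows "dinv (a # \<gamma>) = row_dinv a \<gamma> + dinv \<gamma>"
proof -
  let ?good = "\<lambda>\<gamma> c. arm \<gamma> c - leg \<gamma> c \<in> {0, 1}"
  let ?R = "{j \<in> {1..a}. int a - int j - int (length (filter (\<lambda>x. j \<le> x) \<gamma>)) \<in> {0, 1}}"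
  let ?s = "\<lambda>(i, j). (Suc i, j)"
  have first: "?good (a # \<gamma>) (1, j) \<longleftrightarrow> int a - int j - int (length (filter (\<lambda>x. j \<le> x) \<gamma>)) \<in> {0, 1}"
    if "j \<in> {1..a}" for j
    using that leg_eq[OF assms, of 1 j] by (auto simp: arm_def diagram_Cons)
  have rest: "?good (a # \<gamma>) (?s c) \<longleftrightarrow> ?good \<gamma> c" if "c \<in> diagram \<gamma>" for c
  proof (cases c)
    case (Pair i j)
    have ij: "1 \<le> i" "1 \<le> i \<and> i \<le> length \<gamma>" "j \<le> part \<gamma> i" using that Pair by (auto simp: diagram_def)
    have "j \<le> a" using ij part_le_hd[OF assms, of "Suc i"] by simp
    moreover have "(Suc i, j) \<in> diagram (a # \<gamma>)" using that Pair by (auto simp: diagram_Cons)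
    ultimately have "leg (a # \<gamma>) (Suc i, j) = leg \<gamma> (i, j)"
      using leg_eq[OF assms, of "Suc i" j] leg_eq[of \<gamma> i j] assms that Pair by simp
    then show ?thesis using Pair ij by (simp add: arm_def)
  qed
  have "{c \<in> diagram (a # \<gamma>). ?good (a # \<gamma>) c} =
      {c \<in> {1} \<times> {1..a}. ?good (a # \<gamma>) c} \<union> {c \<in> ?s ` diagram \<gamma>. ?good (a # \<gamma>) c}"
    by (auto simp: diagram_Cons)
  moreover have "{c \<in> {1} \<times> {1..a}. ?good (a # \<gamma>) c} = Pair 1 ` ?R"
  proof -
    have "{c \<in> {1} \<times> {1..a}. Q c} = Pair 1 ` {j \<in> {1..a}. Q (1, j)}" for Q :: "nat \<times> nat \<Rightarrow> bool"
      by auto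
    then show ?thesis using first by (simp only: cong: conj_cong)
  qed
  moreover have "{c \<in> ?s ` diagram \<gamma>. ?good (a # \<gamma>) c} = ?s ` {c \<in> diagram \<gamma>. ?good \<gamma> c}"
    unfolding Compr_image_eq using rest by (simp only: cong: conj_cong)
  moreover have "finite (diagram \<gamma>)"
  proof (rule finite_subset)
    show "diagram \<gamma> \<subseteq> {..length \<gamma>} \<times> (\<Union>i\<le>length \<gamma>. {..part \<gamma> i})" by (auto simp: diagram_def)
  qed auto
  moreover have "Pair 1 ` ?R \<inter> ?s ` {c \<in> diagram \<gamma>. ?good \<gamma> c} = {}"
    by (auto simp: diagram_def)
  ultimately have "dinv (a # \<gamma>) = card (Pair (1::nat) ` ?R) + card (?s ` {c \<in> diagram \<gamma>. ?good \<gamma> c})"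
    unfolding dinv_def by (simp add: card_Un_disjoint)
  also have "card (Pair (1::nat) ` ?R) = row_dinv a \<gamma>"
    unfolding row_dinv_def by (rule card_image) (auto simp: inj_on_def)
  also have "card (?s ` {c \<in> diagram \<gamma>. ?good \<gamma> c}) = dinv \<gamma>"
    unfolding dinv_def by (rule card_image) (auto simp: inj_on_def)
  finally show ?thesis .
qed

text \<open>The number of the two thresholds 0 and 1 that \<open>s\<close> has reached. For a walk with steps \<open>+1\<close>
and \<open>-1\<close> the increase of this number is the number of upward minus the number of downward
crossings of the thresholds.\<close>

definition crossings :: "int \<Rightarrow> nat" where
  "crossings s = (if 0 \<le> s then 1 else 0) + (if 1 \<le> s then 1 else 0)"

lemma card_crossings:
  "card {j \<in> {1..m}. t + 1 - int j \<in> {0, 1}} + crossings (t - int m) = crossings t"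
proof (induction m)
  case (Suc m)
  have "{j \<in> {1..Suc m}. t + 1 - int j \<in> {0, 1}} =
      {j \<in> {1..m}. t + 1 - int j \<in> {0, 1}} \<union> (if t - int m \<in> {0, 1} then {Suc m} else {})"
    by (auto simp: le_Suc_eq)
  then have "card {j \<in> {1..Suc m}. t + 1 - int j \<in> {0, 1}} =
      card {j \<in> {1..m}. t + 1 - int j \<in> {0, 1}} + (if t - int m \<in> {0, 1} then 1 else 0)"
    by auto
  with Suc show ?case by (auto simp: crossings_def split: if_splits)
qed simp

lemma links_stair: "links c (stair n) = crossings (int n - 1 - int c)"
  by (induction n) (auto simp: crossings_def)

text \<open>Follow the boundary of the partition down from the end of a row of length \<open>h\<close>, scoring \<open>+1\<close>
for each column passed and \<open>-1\<close> for each row. At a column \<open>j\<close>, arm minus leg tells whether the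
score rises to 0 or to 1; at a later row, the difference of letters tells whether it falls from 0
or from 1. So cells of the row counted by dinv are upward crossings and linked letters are
downward crossings. They are equally many when the walk begins and ends at negative scores. The
score at the end is \<open>- 1 - c\<close>, hence negative; the score at the beginning is kept general for the
induction, which removes the first of the lower rows.\<close>

lemma links_word_of:
  assumes "is_partition \<gamma>" "fits n \<gamma>" "\<forall>x\<in>set \<gamma>. x \<le> h"
  shows "card {j \<in> {1..h}. int n - int c - int j - int (length (filter (\<lambda>x. j \<le> x) \<gamma>)) \<in> {0, 1}}
     + crossings (int n - 1 - int c - int h) = links c (word_of n \<gamma>)"
  using assms
proof (induction \<gamma> arbitrary: n h)
  case Nil
  then show ?case
    using card_crossings[of h "int n - 1 - int c"] by (simp add: links_stair algebra_simps)
next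
  case (Cons r \<gamma>)
  then obtain m where n: "n = Suc m" by (cases n) auto
  let ?P = "\<lambda>j. int n - int c - int j - int (length (filter (\<lambda>x. j \<le> x) (r # \<gamma>))) \<in> {0, 1}"
  let ?Q = "\<lambda>j. int m - int c - int j - int (length (filter (\<lambda>x. j \<le> x) \<gamma>)) \<in> {0, 1}"
  define t where "t = int m - int c - int r"
  have "{j \<in> {1..h}. ?P j} = {j \<in> {1..r}. ?Q j} \<union> (\<lambda>i. r + i) ` {i \<in> {1..h - r}. t + 1 - int i \<in> {0, 1}}"
    (is "_ = ?A \<union> ?B")
  proof -
    have low: "?P j \<longleftrightarrow> ?Q j" if "j \<le> r" for j
    proof -
      have "int n - int c - int j - int (length (filter (\<lambda>x. j \<le> x) (r # \<gamma>))) =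
          int m - int c - int j - int (length (filter (\<lambda>x. j \<le> x) \<gamma>))"
        using that n by simp
      then show ?thesis by (simp only:)
    qed
    have high: "?P (r + i) \<longleftrightarrow> t + 1 - int i \<in> {0, 1}" if "1 \<le> i" for i
    proof -
      have "filter (\<lambda>x. r + i \<le> x) (r # \<gamma>) = []"
        using Cons.prems that by (auto simp: filter_empty_conv)
      then show ?thesis using n by (simp add: t_def algebra_simps)
    qed
    have "{1..h} = {1..r} \<union> (\<lambda>i. r + i) ` {1..h - r}"
      using Cons.prems by (auto simp: image_iff)
    moreover have "{j \<in> A \<union> (\<lambda>i. r + i) ` B. Q j} = {j \<in> A. Q j} \<union> (\<lambda>i. r + i) ` {i \<in> B. Q (r + i)}"
      for A B Q by blast
    ultimately have "{j \<in> {1..h}. ?P j} = {j \<in> {1..r}. ?P j} \<union> (\<lambda>i. r + i) ` {i \<in> {1..h - r}. ?P (r + i)}"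
      by (simp only:)
    also have "{j \<in> {1..r}. ?P j} = ?A" using low by auto
    also have "{i \<in> {1..h - r}. ?P (r + i)} = {i \<in> {1..h - r}. t + 1 - int i \<in> {0, 1}}"
      using high by auto
    finally show ?thesis .
  qed
  moreover have "card (?A \<union> ?B) = card ?A + card ?B"
    by (rule card_Un_disjoint) auto
  moreover have "card ?B = card {i \<in> {1..h - r}. t + 1 - int i \<in> {0, 1}}"
    by (rule card_image) (auto simp: inj_on_def)
  ultimately have "card {j \<in> {1..h}. ?P j} = card ?A + card {i \<in> {1..h - r}. t + 1 - int i \<in> {0, 1}}"
    by (simp only:)
  moreover have "crossings t = crossings (t - 1) + (if t \<in> {0, 1} then 1 else 0)"
    by (auto simp: crossings_def)
  moreover have "card {i \<in> {1..h - r}. t + 1 - int i \<in> {0, 1}} + crossings (t - int (h - r)) = crossings t"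
    by (rule card_crossings)
  moreover have "int n - 1 - int c - int h = t - int (h - r)"
    using Cons.prems n by (simp add: t_def of_nat_diff)
  moreover have "card ?A + crossings (t - 1) = links c (word_of m \<gamma>)"
    using Cons.IH[of m r] Cons.prems n by (simp add: t_def algebra_simps)
  moreover have "links c (word_of n (r # \<gamma>)) = links c (word_of m \<gamma>) + (if t \<in> {0, 1} then 1 else 0)"
    using Cons.prems n by (auto simp: t_def)
  ultimately show ?case by simp
qed

lemma winv_word_of: "is_partition \<gamma> \<Longrightarrow> fits n \<gamma> \<Longrightarrow> winv (word_of n \<gamma>) = dinv \<gamma>"
proof (induction n \<gamma> rule: word_of.induct)
  case (1 \<gamma>)
  then show ?case by (cases \<gamma>) auto
next
  case (2 n)
  show ?case using winv_stair[of "Suc n"] by simp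
next
  case (3 n a \<gamma>)
  \<comment> \<open>for a full row both ends of the walk are negative, so no correction terms remain\<close>
  then have "row_dinv a \<gamma> = links (n - a) (word_of n \<gamma>)"
    using links_word_of[of \<gamma> n a "n - a"] by (simp add: row_dinv_def crossings_def of_nat_diff)
  with 3 dinv_Cons[of a \<gamma>] show ?case by simp
qed

lemma coeff_qt_Cat_words:
  assumes "1 \<le> n"
  shows "coeff_qt (Cat n) i j = int (card {u. dyck u \<and> length u = n \<and> sum_list u = i \<and> winv u = j})"
proof -
  have "word_of n ` {\<gamma> \<in> DP n. (n choose 2) - sum_list \<gamma> = i \<and> dinv \<gamma> = j} =
      {u. dyck u \<and> length u = n \<and> sum_list u = i \<and> winv u = j}" (is "_ ` ?A = ?B")
  proof -
    have eq: "(n choose 2) - sum_list \<gamma> = sum_list (word_of n \<gamma>) \<and> dinv \<gamma> = winv (word_of n \<gamma>)"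
      if "\<gamma> \<in> DP n" for \<gamma>
      using that sum_list_word_of[of n \<gamma>] winv_word_of[of \<gamma> n] DP_iff_fits[OF assms] by fastforce
    have "?A = {\<gamma> \<in> DP n. sum_list (word_of n \<gamma>) = i \<and> winv (word_of n \<gamma>) = j}"
      using eq by auto
    then have "word_of n ` ?A = {u \<in> word_of n ` DP n. sum_list u = i \<and> winv u = j}"
      by (simp only: Compr_image_eq)
    then show ?thesis using bij_betw_word_of[OF assms] by (auto simp: bij_betw_def)
  qed
  moreover have "inj_on (word_of n) (DP n)"
    using bij_betw_word_of[OF assms] by (rule bij_betw_imp_inj_on)
  then have "inj_on (word_of n) ?A"
    by (rule inj_on_subset) simp
  then have "card (word_of n ` ?A) = card ?A" by (rule card_image)
  ultimately have "card ?B = card ?A" by (simp only:)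
  then show ?thesis by (simp add: coeff_qt_Cat)
qed

section \<open>Symmetry of the Catalan number\<close>

theorem mainTheorem4:
  fixes n i j :: nat
  assumes "int i + int j \<ge> int (n choose 2) - 11"
  shows "coeff_qt (Cat n) i j = coeff_qt (Cat n) j i"
proof (cases "1 \<le> n \<and> i + j \<le> n choose 2")
  case True
  define k where "k = (n choose 2) - (i + j)"
  have k: "j + i + k = n choose 2" "k \<le> 11" using True assms by (auto simp: k_def)
  have "{u. dyck u \<and> length u = n \<and> sum_list u = a \<and> winv u = b} = {u \<in> words n k. winv u = b}"
    if "a + b = i + j" for a b
    using winv_defect_area k that by (fastforce simp: words_def)
  then show ?thesis
    using True card_winv_symmetric[OF _ balanced[of k n] k(1)] k(2)
    by (simp add: coeff_qt_Cat_words add.commute)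
next
  case False
  show ?thesis
  proof (cases "n = 0")
    case True
    have "0 < min_Delta []" unfolding min_Delta_def by (rule LeastI2[of _ 1]) auto
    then have "DP 0 = {}" using DP_length_le[of _ 0] by (fastforce simp: DP_def)
    then show ?thesis using True by (simp add: coeff_qt_Cat)
  next
    case n: False
    have none: "{u. dyck u \<and> length u = n \<and> sum_list u = a \<and> winv u = b} = {}" if "a + b = i + j" for a b
    proof -
      have False if "dyck u" "length u = n" "sum_list u = a" "winv u = b" for u
        using winv_defect_area[OF that(1)] that \<open>a + b = i + j\<close> False n by simp
      then show ?thesis by blast
    qed
    have "1 \<le> n" using n by simp
    then show ?thesis
      by (simp only: coeff_qt_Cat_words none[OF refl] none[OF add.commute])
  qed
qed

end
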